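(* Let $n,m\geq 1$ and $1\le k\le n$ be integers, let $F\in\mathbb{R}^{n\times m}$, let $\alpha_k\ge 0$ be a constant and let $\beta>0$. Suppose that $$\left(\sqrt{2k\left(1+\log\frac{2n}{k}\right)}+\beta\right)\sigma_k(F)\;\leq\;\left(\sqrt{\frac{2}{\pi}}\sum_{i=1}^n\|F_i\|_2-\beta L(F)\right)\alpha_k .$$ Then, when $y\sim\mathcal{N}(0,\mathbf{I}_m)$, the condition $$\|Fy\|_{k,1}\leq\alpha_k\|Fy\|_1$$ is satisfied with probability at least $1-2e^{-\beta^2/2}$.
   Context: For $x\in\mathbb{R}^n$, $\|x\|_{k,1}$ denotes the sum of the magnitudes (absolute values) of the $k$ largest-magnitude coefficients of $x$. $F_i$ denotes the $i$-th row of $F$ and $\|F_i\|_2$ its Euclidean norm. $\mathbf{1}$ is the all-ones vector, $\otimes$ the Kronecker product. The constants $\sigma_k(F)\ge 0$ and $L(F)\geq 0$ are defined by $$\sigma_k^2(F)=\max_{u\in\{0,1\}^{2n},\ \mathbf{1}^Tu\leq k}u^T\left(\begin{pmatrix}1&-1\\-1&1\end{pmatrix}\otimes FF^T\right)u=\max_{(u_+,u_-)\in\{0,1\}^{2n},\ \mathbf{1}^T(u_++u_-)\le k}\|(u_+-u_-)^TF\|_2^2,$$ where $u=(u_+,u_-)$ with $u_+,u_-\in\{0,1\}^n$, and $$L^2(F)=\max_{v\in\{-1,1\}^n}v^TFF^Tv.$$ *)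

theory Defs
  imports "HOL-Probability.Probability"
begin

text \<open>The magnitudes are collected in a multiset, so that equal ones are counted separately.\<close>

definition k1_norm :: "nat \<Rightarrow> real ^ 'n \<Rightarrow> real" where
  "k1_norm k x =
     sum_list (take k (rev (sorted_list_of_multiset {#\<bar>x $ i\<bar>. i \<in># mset_set UNIV#})))"

definition l1_norm :: "real ^ 'n \<Rightarrow> real" where
  "l1_norm x = (\<Sum>i\<in>UNIV. \<bar>x $ i\<bar>)"

definition kronecker :: "real ^ 'b ^ 'a \<Rightarrow> real ^ 'd ^ 'c \<Rightarrow> real ^ ('b \<times> 'd) ^ ('a \<times> 'c)" where
  "kronecker A B = (\<chi> p q. A $ fst p $ fst q * B $ snd p $ snd q)"

text \<open>Vectors of length \<open>2n\<close> are indexed by \<open>2 \<times> 'n\<close>: the two blocks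
  \<open>u\<^sub>+\<close> and \<open>u\<^sub>-\<close> are the entries with first index \<open>1\<close> and \<open>2\<close>.\<close>

definition sigma_sq :: "nat \<Rightarrow> real ^ 'm ^ 'n \<Rightarrow> real" where
  "sigma_sq k F =
     Max {u \<bullet> (kronecker (vector [vector [1, -1], vector [-1, 1]] :: real ^ 2 ^ 2)
                (F ** transpose F) *v u) | u :: real ^ (2 \<times> 'n).
            (\<forall>p. u $ p \<in> {0, 1}) \<and> (\<Sum>p\<in>UNIV. u $ p) \<le> real k}"

definition sigma_const :: "nat \<Rightarrow> real ^ 'm ^ 'n \<Rightarrow> real" where
  "sigma_const k F = sqrt (sigma_sq k F)"

definition L_sq :: "real ^ 'm ^ 'n \<Rightarrow> real" where
  "L_sq F = Max {v \<bullet> ((F ** transpose F) *v v) | v. \<forall>i. v $ i \<in> {-1, 1}}"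

definition L_const :: "real ^ 'm ^ 'n \<Rightarrow> real" where
  "L_const F = sqrt (L_sq F)"

text \<open>The density of \<open>N(0, I\<^sub>m)\<close> with respect to Lebesgue measure.\<close>

definition std_gaussian_density :: "real ^ 'm \<Rightarrow> real" where
  "std_gaussian_density y = (2 * pi) powr (- real CARD('m) / 2) * exp (- (norm y)\<^sup>2 / 2)"

lemma sum_2_times:
  fixes f :: "2 \<times> 'n::finite \<Rightarrow> real"
  shows "(\<Sum>p\<in>UNIV. f p) = (\<Sum>i\<in>UNIV. f (1, i)) + (\<Sum>i\<in>UNIV. f (2, i))"
  using sum.cartesian_product[of "\<lambda>a b. f (a, b)" UNIV UNIV]
  by (simp add: sum_2)

text \<open>The second expression for \<open>\<sigma>\<^sub>k\<^sup>2\<close>, without the Kronecker product.\<close>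

lemma kron_quadratic:
  fixes F :: "real ^ 'm ^ 'n" and u :: "real ^ (2 \<times> 'n)"
  shows "u \<bullet> (kronecker (vector [vector [1, -1], vector [-1, 1]] :: real ^ 2 ^ 2)
                (F ** transpose F) *v u)
       = (norm (((\<chi> i. u $ (1, i)) - (\<chi> i. u $ (2, i))) v* F))\<^sup>2"
proof -
  define d :: "real ^ 'n" where "d = (\<chi> i. u $ (1, i)) - (\<chi> i. u $ (2, i))"
  define G where "G = F ** transpose F"
  have "u \<bullet> (kronecker (vector [vector [1, -1], vector [-1, 1]] :: real ^ 2 ^ 2) G *v u)
      = d \<bullet> (G *v d)"
    by (simp add: inner_vec_def matrix_vector_mult_def kronecker_def sum_2_times d_def
        sum_distrib_left sum.distrib[symmetric] sum_subtractf[symmetric] sum_negf[symmetric] algebra_simps)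
  also have "\<dots> = (transpose F *v d) \<bullet> (transpose F *v d)"
    by (simp add: G_def matrix_vector_mul_assoc[symmetric] dot_lmul_matrix[symmetric])
  also have "\<dots> = (norm (d v* F))\<^sup>2"
    by (simp add: power2_norm_eq_inner)
  finally show ?thesis
    by (simp add: d_def G_def)
qed

lemma sigma_sq_alt:
  fixes F :: "real ^ 'm ^ 'n"
  shows "sigma_sq k F =
     Max {(norm ((up - um) v* F))\<^sup>2 | up um :: real ^ 'n.
            (\<forall>i. up $ i \<in> {0, 1}) \<and> (\<forall>i. um $ i \<in> {0, 1})
            \<and> (\<Sum>i\<in>UNIV. (up + um) $ i) \<le> real k}"
proof -
  have "{u \<bullet> (kronecker (vector [vector [1, -1], vector [-1, 1]] :: real ^ 2 ^ 2)
                (F ** transpose F) *v u) | u :: real ^ (2 \<times> 'n).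
            (\<forall>p. u $ p \<in> {0, 1}) \<and> (\<Sum>p\<in>UNIV. u $ p) \<le> real k}
      = {(norm ((up - um) v* F))\<^sup>2 | up um :: real ^ 'n.
            (\<forall>i. up $ i \<in> {0, 1}) \<and> (\<forall>i. um $ i \<in> {0, 1})
            \<and> (\<Sum>i\<in>UNIV. (up + um) $ i) \<le> real k}" (is "?A = ?B")
  proof (intro equalityI subsetI)
    fix a assume "a \<in> ?A"
    then obtain u :: "real ^ (2 \<times> 'n)" where u: "\<forall>p. u $ p \<in> {0, 1}"
      "(\<Sum>p\<in>UNIV. u $ p) \<le> real k"
      "a = (norm (((\<chi> i. u $ (1, i)) - (\<chi> i. u $ (2, i))) v* F))\<^sup>2"
      unfolding kron_quadratic by blast
    show "a \<in> ?B"
      unfolding mem_Collect_eq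
      by (rule exI[of _ "\<chi> i. u $ (1, i)"], rule exI[of _ "\<chi> i. u $ (2, i)"])
         (use u in \<open>simp add: sum_2_times sum.distrib\<close>)
  next
    fix a assume "a \<in> ?B"
    then obtain up um :: "real ^ 'n" where u: "\<forall>i. up $ i \<in> {0, 1}" "\<forall>i. um $ i \<in> {0, 1}"
      "(\<Sum>i\<in>UNIV. (up + um) $ i) \<le> real k" "a = (norm ((up - um) v* F))\<^sup>2"
      by blast
    define u :: "real ^ (2 \<times> 'n)" where
      "u = (\<chi> p. if fst p = 1 then up $ snd p else um $ snd p)"
    have "(\<chi> i. u $ (1, i)) = up" "(\<chi> i. u $ (2, i)) = um"
      by (simp_all add: u_def vec_eq_iff)
    moreover have "\<forall>p. u $ p \<in> {0, 1}" "(\<Sum>p\<in>UNIV. u $ p) \<le> real k"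
      using u by (simp_all add: u_def sum_2_times sum.distrib)
    ultimately show "a \<in> ?A"
      unfolding kron_quadratic using u by blast
  qed
  then show ?thesis
    by (simp add: sigma_sq_def)
qed

end

theory Submission
  imports Defs "HOL-Real_Asymp.Real_Asymp"
begin

text \<open>
  The norm \<open>k1_norm k (F y)\<close> is a maximum of at most \<open>(2en/k)\<^sup>k\<close> centred Gaussians of standard
  deviation at most \<open>sigma_const k F\<close>; the union bound already produces the shift
  \<open>sqrt (2k (1 + ln (2n/k)))\<close> of the mean together with the factor \<open>exp (- \<beta>\<^sup>2 / 2)\<close>, so no concentration
  inequality is needed here.

  For \<open>l1_norm (F y)\<close>, which is \<open>L_const F\<close>-Lipschitz in \<open>y\<close>, the bound
  \<open>E exp f \<le> exp (E f + L\<^sup>2 / 2)\<close> with the sharp constant is needed. It is obtained by writing the Gaussian vector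
  as a sum of \<open>N\<close> independent increments of size \<open>1 / sqrt N\<close>: for \<open>f\<close> with a quadratic Taylor bound, each
  increment of the martingale \<open>E (f y | increments so far)\<close> has exponential moment at most
  \<open>exp (L\<^sup>2 / (2N) + C N powr (- 3/2))\<close>, and \<open>N\<close> tends to infinity. The absolute values are smoothed to
  \<open>sqrt (t\<^sup>2 + d\<^sup>2)\<close> for this purpose.
\<close>

subsection \<open>The standard Gaussian measure\<close>

text \<open>Set in an arbitrary Euclidean space, so that coordinates are inner products with
  \<open>Basis\<close>; on \<open>real ^ 'm\<close> this is
  \<open>std_gaussian_density\<close>.\<close>

definition gauss_density :: "'a::euclidean_space \<Rightarrow> real" where
  "gauss_density z = (2 * pi) powr (- real DIM('a) / 2) * exp (- (norm z)\<^sup>2 / 2)"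

definition gauss :: "'a::euclidean_space measure" where
  "gauss = density lborel (\<lambda>z. ennreal (gauss_density z))"

lemma sets_gauss [simp, measurable_cong]: "sets gauss = sets borel"
  by (simp add: gauss_def)

lemma space_gauss [simp]: "space gauss = UNIV"
  by (simp add: gauss_def)

lemma gauss_density_nonneg [simp]: "0 \<le> gauss_density z"
  by (simp add: gauss_density_def)

lemma borel_measurable_gauss_density [measurable]: "gauss_density \<in> borel_measurable borel"
  unfolding gauss_density_def by measurable

lemma nn_integral_gauss:
  "f \<in> borel_measurable borel \<Longrightarrow>
    (\<integral>\<^sup>+z. f z \<partial>gauss) = (\<integral>\<^sup>+z. ennreal (gauss_density z) * f z \<partial>lborel)"
  unfolding gauss_def by (subst nn_integral_density) auto

lemma gauss_density_prod:
  "gauss_density (z::'a::euclidean_space) = (\<Prod>b\<in>Basis. std_normal_density (z \<bullet> b))"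
proof -
  have "1 / sqrt (2 * pi) = (2 * pi) powr (- 1 / 2)"
    using powr_minus_divide[of "2 * pi" "1 / 2"] by (simp add: powr_half_sqrt)
  then have "(1 / sqrt (2 * pi)) ^ DIM('a) = ((2 * pi) powr (- 1 / 2)) ^ DIM('a)"
    by (rule arg_cong)
  also have "\<dots> = (2 * pi) powr (- real DIM('a) / 2)"
    by (subst powr_realpow[symmetric]) (simp_all add: powr_powr)
  finally have "(1 / sqrt (2 * pi)) ^ DIM('a) = (2 * pi) powr (- real DIM('a) / 2)" .
  moreover have "(\<Sum>b\<in>Basis. - (z \<bullet> b)\<^sup>2 / 2) = - (norm z)\<^sup>2 / 2"
    unfolding power2_norm_eq_inner euclidean_inner[of z z]
    by (simp add: sum_negf sum_divide_distrib[symmetric] power2_eq_square)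
  ultimately show ?thesis
    by (simp only: gauss_density_def std_normal_density_def prod.distrib exp_sum[OF finite_Basis, symmetric]
        prod_constant)
qed

text \<open>The density factors over the basis, so the mass of a box is a product of one-dimensional
  masses. The box with all sides \<open>UNIV\<close> gives total mass 1, and general boxes give the
  independence of the coordinates.\<close>

lemma emeasure_gauss_box:
  fixes A :: "'a::euclidean_space \<Rightarrow> real set"
  assumes A [measurable]: "\<And>b. b \<in> Basis \<Longrightarrow> A b \<in> sets borel"
  shows "emeasure gauss {z. \<forall>b\<in>Basis. z \<bullet> b \<in> A b}
    = (\<Prod>b\<in>Basis. emeasure (density lborel std_normal_density) (A b))"
proof -
  define f where "f b x = ennreal (std_normal_density x) * indicator (A b) x" for b x
  have f [measurable]: "b \<in> Basis \<Longrightarrow> f b \<in> borel_measurable borel" for b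
    unfolding f_def by measurable
  have [measurable]: "{z. \<forall>b\<in>Basis. z \<bullet> b \<in> A b} \<in> sets borel"
    by measurable
  have "emeasure gauss {z. \<forall>b\<in>Basis. z \<bullet> b \<in> A b}
      = (\<integral>\<^sup>+z. (\<Prod>b\<in>Basis. f b (z \<bullet> b)) \<partial>lborel)"
    unfolding gauss_def f_def
    by (subst emeasure_density)
      (auto simp: gauss_density_prod prod.distrib prod_ennreal[symmetric] prod_nonneg
        intro!: nn_integral_cong split: split_indicator)
  also have "\<dots> = (\<Prod>b\<in>Basis. \<integral>\<^sup>+x. f b x \<partial>lborel)"
    by (rule nn_integral_lborel_prod) (auto simp: f_def)
  also have "\<dots> = (\<Prod>b\<in>Basis. emeasure (density lborel std_normal_density) (A b))"
    by (rule prod.cong) (auto simp: f_def emeasure_density)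
  finally show ?thesis .
qed

interpretation std_normal: prob_space "density lborel std_normal_density"
  by (rule prob_space_normal_density) simp

lemma prob_space_gauss: "prob_space (gauss :: 'a::euclidean_space measure)"
proof
  have "emeasure gauss {z::'a. \<forall>b\<in>Basis. z \<bullet> b \<in> UNIV} = 1"
    by (subst emeasure_gauss_box) (simp_all add: std_normal.emeasure_space_1[simplified])
  then show "emeasure gauss (space gauss :: 'a set) = 1"
    by simp
qed

interpretation gauss: prob_space "gauss :: 'a::euclidean_space measure"
  by (rule prob_space_gauss)

section \<open>Rotation invariance of a pair of independent Gaussians\<close>

lemma nn_integral_lborel_affine:
  fixes f :: "'a::euclidean_space \<Rightarrow> ennreal"
  assumes [measurable]: "f \<in> borel_measurable borel" and c: "0 < c"
  shows "(\<integral>\<^sup>+x. f x \<partial>lborel) = ennreal (c ^ DIM('a)) * (\<integral>\<^sup>+x. f (t + c *\<^sub>R x) \<partial>lborel)"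
  by (subst lborel_affine[of c t])
    (use c in \<open>auto simp: nn_integral_density nn_integral_distr nn_integral_cmult abs_of_pos\<close>)

lemma nn_integral_gauss_density: "(\<integral>\<^sup>+z. ennreal (gauss_density (z::'a::euclidean_space)) \<partial>lborel) = 1"
  using nn_integral_gauss[of "\<lambda>_::'a. 1"] gauss.emeasure_space_1[where 'a='a] by simp

text \<open>With x = (u - b y) / a one has u = a x + b y and (y - b u) / a = a y - b x. This is an
  orthogonal change of (x, y), so the sum of the squared norms, on which the product density
  depends, is preserved.\<close>

lemma gauss_density_rotate:
  fixes u y :: "'a::euclidean_space"
  assumes a: "0 < a" and ab: "a\<^sup>2 + b\<^sup>2 = 1"
  shows "gauss_density y * gauss_density ((1 / a) *\<^sub>R (u - b *\<^sub>R y))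
    = gauss_density u * gauss_density ((1 / a) *\<^sub>R (y - b *\<^sub>R u))"
proof -
  have "a\<^sup>2 * (norm y)\<^sup>2 + (norm (u - b *\<^sub>R y))\<^sup>2 = a\<^sup>2 * (norm u)\<^sup>2 + (norm (y - b *\<^sub>R u))\<^sup>2"
  proof -
    have "a\<^sup>2 = 1 - b\<^sup>2" using ab by simp
    then show ?thesis
      by (simp only: power2_norm_eq_inner)
        (simp add: inner_diff_left inner_diff_right inner_commute algebra_simps power2_eq_square)
  qed
  then have "a\<^sup>2 * ((norm y)\<^sup>2 + (norm ((1 / a) *\<^sub>R (u - b *\<^sub>R y)))\<^sup>2)
      = a\<^sup>2 * ((norm u)\<^sup>2 + (norm ((1 / a) *\<^sub>R (y - b *\<^sub>R u)))\<^sup>2)"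
    using a by (simp only: norm_scaleR power_mult_distrib distrib_left)
      (simp add: power_divide)
  then have "(norm y)\<^sup>2 + (norm ((1 / a) *\<^sub>R (u - b *\<^sub>R y)))\<^sup>2
      = (norm u)\<^sup>2 + (norm ((1 / a) *\<^sub>R (y - b *\<^sub>R u)))\<^sup>2"
    using a by (metis mult_left_cancel less_irrefl zero_less_power)
  then show ?thesis
    by (simp add: gauss_density_def mult_ac exp_add[symmetric] add_divide_distrib[symmetric] del: norm_scaleR)
qed

text \<open>Substituting u = a x + b y in the inner integral moves y out of \<open>f\<close> and
  into the densities. After the rotation identity and Fubini, y occurs in a single Gaussian factor,
  which integrates to 1.\<close>

lemma nn_integral_gauss_rotate:
  fixes f :: "'a::euclidean_space \<Rightarrow> ennreal"
  assumes [measurable]: "f \<in> borel_measurable borel" and a: "0 < a" and ab: "a\<^sup>2 + b\<^sup>2 = 1"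
  shows "(\<integral>\<^sup>+y. \<integral>\<^sup>+x. f (a *\<^sub>R x + b *\<^sub>R y) \<partial>gauss \<partial>gauss) = (\<integral>\<^sup>+u. f u \<partial>gauss)"
proof -
  \<comment> \<open>The Jacobian of the substitution x = (u - b y) / a.\<close>
  define s where "s = ennreal ((1 / a) ^ DIM('a))"
  interpret lborel_pair: pair_sigma_finite "lborel :: 'a measure" "lborel :: 'a measure" ..
  let ?g = "\<lambda>z::'a. ennreal (gauss_density z)"
  have mean: "s * (\<integral>\<^sup>+y. ?g ((1 / a) *\<^sub>R (y - t)) \<partial>lborel) = 1" for t
    using nn_integral_lborel_affine[of ?g "1 / a" "- (1 / a) *\<^sub>R t"] a
    by (simp add: nn_integral_gauss_density s_def scaleR_diff_right)
  have "(\<integral>\<^sup>+x. f (a *\<^sub>R x + b *\<^sub>R y) \<partial>gauss)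
      = s * (\<integral>\<^sup>+u. ?g ((1 / a) *\<^sub>R (u - b *\<^sub>R y)) * f u \<partial>lborel)" for y
  proof -
    have "(\<integral>\<^sup>+x. f (a *\<^sub>R x + b *\<^sub>R y) \<partial>gauss) = (\<integral>\<^sup>+x. ?g x * f (a *\<^sub>R x + b *\<^sub>R y) \<partial>lborel)"
      by (rule nn_integral_gauss) simp
    also have "\<dots> = s * (\<integral>\<^sup>+u. ?g (- (1 / a) *\<^sub>R (b *\<^sub>R y) + (1 / a) *\<^sub>R u)
        * f (a *\<^sub>R (- (1 / a) *\<^sub>R (b *\<^sub>R y) + (1 / a) *\<^sub>R u) + b *\<^sub>R y) \<partial>lborel)"
      unfolding s_def using a by (intro nn_integral_lborel_affine) auto
    finally show ?thesis
      using a by (simp add: scaleR_add_right scaleR_diff_right)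
  qed
  then have "(\<integral>\<^sup>+y. \<integral>\<^sup>+x. f (a *\<^sub>R x + b *\<^sub>R y) \<partial>gauss \<partial>gauss)
      = (\<integral>\<^sup>+y. s * (\<integral>\<^sup>+u. ?g ((1 / a) *\<^sub>R (u - b *\<^sub>R y)) * f u \<partial>lborel) \<partial>gauss)"
    by (simp only:)
  also have "\<dots> = (\<integral>\<^sup>+y. ?g y * (s * (\<integral>\<^sup>+u. ?g ((1 / a) *\<^sub>R (u - b *\<^sub>R y)) * f u \<partial>lborel)) \<partial>lborel)"
    by (rule nn_integral_gauss) measurable
  also have "\<dots> = (\<integral>\<^sup>+y. \<integral>\<^sup>+u. ?g y * (s * (?g ((1 / a) *\<^sub>R (u - b *\<^sub>R y)) * f u)) \<partial>lborel \<partial>lborel)"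
    by (simp add: nn_integral_cmult)
  also have "\<dots> = (\<integral>\<^sup>+y. \<integral>\<^sup>+u. ?g u * f u * (s * ?g ((1 / a) *\<^sub>R (y - b *\<^sub>R u))) \<partial>lborel \<partial>lborel)"
  proof (intro nn_integral_cong)
    fix y u :: 'a
    have "?g y * ?g ((1 / a) *\<^sub>R (u - b *\<^sub>R y)) = ?g u * ?g ((1 / a) *\<^sub>R (y - b *\<^sub>R u))"
      using gauss_density_rotate[OF a ab] by (simp add: ennreal_mult[symmetric])
    then show "?g y * (s * (?g ((1 / a) *\<^sub>R (u - b *\<^sub>R y)) * f u))
        = ?g u * f u * (s * ?g ((1 / a) *\<^sub>R (y - b *\<^sub>R u)))"
      by (metis (no_types, lifting) mult.assoc mult.commute)
  qed
  also have "\<dots> = (\<integral>\<^sup>+u. \<integral>\<^sup>+y. ?g u * f u * (s * ?g ((1 / a) *\<^sub>R (y - b *\<^sub>R u))) \<partial>lborel \<partial>lborel)"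
    by (rule lborel_pair.Fubini') measurable
  also have "\<dots> = (\<integral>\<^sup>+u. ?g u * f u \<partial>lborel)"
    using mean by (simp add: nn_integral_cmult)
  finally show ?thesis
    by (simp add: nn_integral_gauss)
qed

section \<open>Coordinates and linear functionals of a Gaussian vector\<close>

lemma distributed_gauss_Basis:
  assumes b: "(b::'a::euclidean_space) \<in> Basis"
  shows "distributed gauss lborel (\<lambda>z. z \<bullet> b) std_normal_density"
proof -
  have "distr gauss lborel (\<lambda>z. z \<bullet> b) = density lborel std_normal_density"
  proof (rule measure_eqI)
    fix S assume "S \<in> sets (distr gauss lborel (\<lambda>z. z \<bullet> b))"
    then have S [measurable]: "S \<in> sets borel" by simp
    have "(\<lambda>z. z \<bullet> b) -` S = {z. \<forall>c\<in>Basis. z \<bullet> c \<in> (if c = b then S else UNIV)}"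
      using b by auto
    then have "emeasure gauss ((\<lambda>z. z \<bullet> b) -` S)
        = (\<Prod>c\<in>Basis. emeasure (density lborel std_normal_density) (if c = b then S else UNIV))"
      using emeasure_gauss_box[of "\<lambda>c. if c = b then S else UNIV"] by simp
    also have "\<dots> = (\<Prod>c\<in>Basis. if c = b then emeasure (density lborel std_normal_density) S else 1)"
      by (rule prod.cong) (simp_all add: std_normal.emeasure_space_1[simplified])
    also have "\<dots> = emeasure (density lborel std_normal_density) S"
      using b by simp
    finally show "emeasure (distr gauss lborel (\<lambda>z. z \<bullet> b)) S = emeasure (density lborel std_normal_density) S"
      by (simp add: emeasure_distr)
  qed simp
  then show ?thesis
    by (simp add: distributed_def)
qed

text \<open>The joint law of the coordinates agrees with the product of the marginals on boxes, and
  boxes determine the product measure.\<close>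

lemma indep_vars_gauss_Basis:
  "gauss.indep_vars (\<lambda>_. borel) (\<lambda>b z. z \<bullet> b) (Basis :: 'a::euclidean_space set)"
proof -
  let ?P = "\<lambda>b::'a. distr gauss borel (\<lambda>z. z \<bullet> b)"
  have marginal: "?P b = density lborel std_normal_density" if "b \<in> Basis" for b
    using distributed_distr_eq_density[OF distributed_gauss_Basis[OF that]]
    by (simp cong: distr_cong)
  interpret product_prob_space ?P Basis
    by (intro product_prob_spaceI gauss.prob_space_distr) simp
  have "distr gauss (\<Pi>\<^sub>M b\<in>Basis. borel) (\<lambda>z. \<lambda>b\<in>Basis. z \<bullet> b) = (\<Pi>\<^sub>M b\<in>Basis. ?P b)"
  proof (rule PiM_eqI)
    fix A assume "\<And>b::'a. b \<in> Basis \<Longrightarrow> A b \<in> sets (?P b)"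
    then have A [measurable]: "\<And>b::'a. b \<in> Basis \<Longrightarrow> A b \<in> sets borel" by simp
    have *: "(\<lambda>z. \<lambda>b\<in>Basis. z \<bullet> b) -` Pi\<^sub>E Basis A = {z::'a. \<forall>b\<in>Basis. z \<bullet> b \<in> A b}"
      by (auto simp: PiE_iff)
    have "(\<Prod>b\<in>Basis. emeasure (density lborel std_normal_density) (A b)) = (\<Prod>b\<in>Basis. emeasure (?P b) (A b))"
      by (rule prod.cong[OF refl]) (subst marginal, assumption, rule refl)
    with * show "emeasure (distr gauss (\<Pi>\<^sub>M b\<in>Basis. borel) (\<lambda>z. \<lambda>b\<in>Basis. z \<bullet> b)) (Pi\<^sub>E Basis A)
        = (\<Prod>b\<in>Basis. emeasure (?P b) (A b))"
      by (subst emeasure_distr) (auto simp: emeasure_gauss_box intro!: sets_PiM_I_finite)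
  qed (auto intro!: sets_PiM_cong)
  then show ?thesis
    by (subst gauss.indep_vars_iff_distr_eq_PiM') auto
qed

lemma distributed_gauss_inner:
  fixes a :: "'a::euclidean_space"
  assumes "a \<noteq> 0"
  shows "distributed gauss lborel (\<lambda>z. a \<bullet> z) (normal_density 0 (norm a))"
proof -
  \<comment> \<open>Coordinates with coefficient 0 are dropped, because the rule for sums of
    independent normals asks for positive standard deviations.\<close>
  define I where "I = {b \<in> Basis. a \<bullet> b \<noteq> 0}"
  have I: "finite I" "I \<subseteq> Basis" by (auto simp: I_def)
  have "I \<noteq> {}"
    using assms euclidean_all_zero_iff[of a] by (auto simp: I_def)
  have nz: "b \<in> Basis - I \<Longrightarrow> a \<bullet> b = 0" for b by (auto simp: I_def)
  have "gauss.indep_vars (\<lambda>_. borel) (\<lambda>b z. z \<bullet> b) I"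
    using indep_vars_gauss_Basis I(2) by (rule gauss.indep_vars_subset)
  then have "gauss.indep_vars (\<lambda>_. borel) (\<lambda>b z. (a \<bullet> b) * (z \<bullet> b)) I"
    by (rule gauss.indep_vars_compose2) simp
  then have "distributed gauss lborel (\<lambda>z. \<Sum>b\<in>I. (a \<bullet> b) * (z \<bullet> b))
      (normal_density (\<Sum>b\<in>I. 0) (sqrt (\<Sum>b\<in>I. \<bar>a \<bullet> b\<bar>\<^sup>2)))"
  proof (rule gauss.sum_indep_normal[OF \<open>finite I\<close> \<open>I \<noteq> {}\<close>])
    fix b assume "b \<in> I"
    then have b: "b \<in> Basis" "a \<bullet> b \<noteq> 0" by (auto simp: I_def)
    show "0 < \<bar>a \<bullet> b\<bar>" using b by simp
    have "distributed gauss lborel (\<lambda>z. 0 + (a \<bullet> b) * (z \<bullet> b))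
        (normal_density (0 + (a \<bullet> b) * 0) (\<bar>a \<bullet> b\<bar> * 1))"
      by (rule gauss.normal_density_affine[OF distributed_gauss_Basis[OF b(1)]]) (use b in auto)
    then show "distributed gauss lborel (\<lambda>z. (a \<bullet> b) * (z \<bullet> b)) (normal_density 0 \<bar>a \<bullet> b\<bar>)"
      by simp
  qed
  moreover have "(\<Sum>b\<in>I. (a \<bullet> b) * (z \<bullet> b)) = a \<bullet> z" for z
    unfolding euclidean_inner[of a z] by (rule sum.mono_neutral_left) (use I nz in auto)
  moreover have "(\<Sum>b\<in>I. \<bar>a \<bullet> b\<bar>\<^sup>2) = (norm a)\<^sup>2"
    unfolding power2_norm_eq_inner euclidean_inner[of a a]
    by (rule sum.mono_neutral_cong_left) (use I nz in \<open>auto simp: power2_eq_square\<close>)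
  ultimately show ?thesis
    by simp
qed

lemma has_bochner_integral_distributed:
  assumes D: "distributed M lborel X f" and f: "\<And>x. 0 \<le> f x"
    and [measurable]: "g \<in> borel_measurable borel"
    and g: "has_bochner_integral lborel (\<lambda>x. f x * g x) (c::real)"
  shows "has_bochner_integral M (\<lambda>x. g (X x)) c"
proof -
  have "integrable M (\<lambda>x. g (X x))"
    using distributed_integrable[OF D, of g] g f by (auto simp: has_bochner_integral_iff)
  moreover have "(\<integral>x. g (X x) \<partial>M) = c"
    using distributed_integral[OF D, of g] g f by (auto simp: has_bochner_integral_iff)
  ultimately show ?thesis
    by (simp add: has_bochner_integral_iff)
qed

lemma has_bochner_integral_gauss_inner:
  "has_bochner_integral gauss (\<lambda>z. a \<bullet> z) (0::real)"
proof (cases "a = 0")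
  case False
  then show ?thesis
    using normal_moment_odd[of "norm a" 0 0]
    by (intro has_bochner_integral_distributed[OF distributed_gauss_inner]) auto
qed (simp add: has_bochner_integral_zero)

lemma has_bochner_integral_gauss_inner_sq:
  "has_bochner_integral gauss (\<lambda>z. (a \<bullet> z)\<^sup>2) ((norm a)\<^sup>2)"
proof (cases "a = 0")
  case False
  then show ?thesis
    using normal_moment_even[of "norm a" 0 1]
    by (intro has_bochner_integral_distributed[OF distributed_gauss_inner, where g="\<lambda>x. x\<^sup>2"])
      (auto simp: fact_numeral)
qed (simp add: has_bochner_integral_zero)

lemma has_bochner_integral_gauss_abs_inner:
  "has_bochner_integral gauss (\<lambda>z. \<bar>a \<bullet> z\<bar>) (sqrt (2 / pi) * norm a)"
proof (cases "a = 0")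
  case False
  then show ?thesis
    using normal_moment_abs_odd[of "norm a" 0 0]
    by (intro has_bochner_integral_distributed[OF distributed_gauss_inner, where g=abs])
      (auto simp: mult_ac)
qed (simp add: has_bochner_integral_zero)

section \<open>Exponential moments and integrability\<close>

lemma nn_integral_gauss_exp_inner:
  "(\<integral>\<^sup>+z. ennreal (exp (a \<bullet> z)) \<partial>gauss) = ennreal (exp ((norm a)\<^sup>2 / 2))"
proof -
  \<comment> \<open>Completing the square: tilting by \<open>exp (a \<bullet> z)\<close> recentres
    the density at \<open>a\<close>.\<close>
  have eq: "gauss_density z * exp (a \<bullet> z) = exp ((norm a)\<^sup>2 / 2) * gauss_density (- a + z)" for z
    by (simp add: gauss_density_def exp_add[symmetric] mult.left_commute)
      (simp add: power2_norm_eq_inner inner_diff_left inner_diff_right inner_commute field_simps)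
  have "(\<integral>\<^sup>+z. ennreal (exp (a \<bullet> z)) \<partial>gauss) = (\<integral>\<^sup>+z. ennreal (exp ((norm a)\<^sup>2 / 2)) * ennreal (gauss_density (- a + z)) \<partial>lborel)"
    by (subst nn_integral_gauss) (simp_all add: ennreal_mult[symmetric] eq)
  also have "\<dots> = ennreal (exp ((norm a)\<^sup>2 / 2)) * (\<integral>\<^sup>+z. ennreal (gauss_density (- a + z)) \<partial>lborel)"
    by (rule nn_integral_cmult) simp
  also have "(\<integral>\<^sup>+z. ennreal (gauss_density (- a + z)) \<partial>lborel) = 1"
    using nn_integral_lborel_affine[of "\<lambda>z. ennreal (gauss_density z)" 1 "- a"]
    by (simp add: nn_integral_gauss_density)
  finally show ?thesis by simp
qed

text \<open>The bound c t \<le> c^2 + t^2 / 4 uses up half of the Gaussian exponent. The other half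
  is the exponent of the density rescaled by 1 / sqrt 2, which has finite mass.\<close>

lemma integrable_gauss_exp_norm:
  "integrable gauss (\<lambda>z::'a::euclidean_space. exp (c * norm z))"
proof (rule integrableI_bounded)
  define s where "s = 1 / sqrt 2"
  have s: "s > 0" "s\<^sup>2 = 1 / 2" by (simp_all add: s_def power_divide)
  have eq: "gauss_density z * exp (c * norm z) \<le> exp (c\<^sup>2) * gauss_density (0 + s *\<^sub>R z)" for z :: 'a
  proof -
    have "0 \<le> (norm z / 2 - c)\<^sup>2" by simp
    then have "c * norm z \<le> c\<^sup>2 + (norm z)\<^sup>2 / 4"
      by (simp add: power2_diff power_divide mult.commute)
    then have "exp (- (norm z)\<^sup>2 / 2) * exp (c * norm z) \<le> exp (c\<^sup>2) * exp (- (norm (s *\<^sub>R z))\<^sup>2 / 2)"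
      by (simp add: exp_add[symmetric] power_mult_distrib s(2))
    from mult_left_mono[OF this, of "(2 * pi) powr (- real DIM('a) / 2)"] show ?thesis
      by (simp add: gauss_density_def mult_ac)
  qed
  have "(\<integral>\<^sup>+z. ennreal (norm (exp (c * norm (z::'a)))) \<partial>gauss)
      \<le> (\<integral>\<^sup>+z. ennreal (exp (c\<^sup>2)) * ennreal (gauss_density (0 + s *\<^sub>R (z::'a))) \<partial>lborel)"
    by (subst nn_integral_gauss)
      (use eq in \<open>auto simp: ennreal_mult[symmetric] intro!: nn_integral_mono ennreal_leI\<close>)
  also have "\<dots> = ennreal (exp (c\<^sup>2)) * (\<integral>\<^sup>+z. ennreal (gauss_density (0 + s *\<^sub>R (z::'a))) \<partial>lborel)"
    by (rule nn_integral_cmult) simp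
  also have "\<dots> < \<infinity>"
  proof -
    have "ennreal (s ^ DIM('a)) * (\<integral>\<^sup>+z. ennreal (gauss_density (0 + s *\<^sub>R (z::'a))) \<partial>lborel) = 1"
      using nn_integral_lborel_affine[of "\<lambda>z::'a. ennreal (gauss_density z)" s 0] s
      by (simp add: nn_integral_gauss_density)
    then have "(\<integral>\<^sup>+z. ennreal (gauss_density (0 + s *\<^sub>R (z::'a))) \<partial>lborel) \<noteq> \<infinity>"
      using s by (auto simp: ennreal_mult_top)
    then show ?thesis
      by (auto simp: ennreal_mult_less_top less_top)
  qed
  finally show "(\<integral>\<^sup>+z. ennreal (norm (exp (c * norm (z::'a)))) \<partial>gauss) < \<infinity>" .
qed simp

lemma power_le_fact_exp:
  assumes "0 \<le> (x::real)"
  shows "x ^ k \<le> fact k * exp x"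
proof -
  have "x ^ k /\<^sub>R fact k \<le> (\<Sum>n. x ^ n /\<^sub>R fact n)"
    using sum_le_suminf[OF summable_exp_generic[of x], of "{k}"] assms by simp
  then have "x ^ k /\<^sub>R fact k \<le> exp x"
    by (simp only: exp_def)
  then show ?thesis
    by (simp add: divide_simps mult.commute)
qed

lemma integrable_gauss_power_exp_norm:
  "integrable gauss (\<lambda>z::'a::euclidean_space. norm z ^ k * exp (c * norm z))"
proof (rule Bochner_Integration.integrable_bound)
  show "integrable gauss (\<lambda>z::'a. fact k * exp ((1 + c) * norm z))"
    by (intro integrable_mult_right integrable_gauss_exp_norm)
  show "AE z::'a in gauss. norm (norm z ^ k * exp (c * norm z)) \<le> norm (fact k * exp ((1 + c) * norm z))"
  proof (rule AE_I2)
    fix z :: 'a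
    have "norm z ^ k * exp (c * norm z) \<le> (fact k * exp (norm z)) * exp (c * norm z)"
      by (intro mult_right_mono power_le_fact_exp) auto
    also have "\<dots> = fact k * exp ((1 + c) * norm z)"
      by (simp add: distrib_right exp_add)
    finally show "norm (norm z ^ k * exp (c * norm z)) \<le> norm (fact k * exp ((1 + c) * norm z))"
      by (simp add: abs_mult)
  qed
qed simp

lemma integrable_gauss_power_norm:
  "integrable gauss (\<lambda>z::'a::euclidean_space. norm z ^ k)"
  using integrable_gauss_power_exp_norm[of k 0] by simp

lemma integrable_gauss_norm: "integrable gauss (\<lambda>z::'a::euclidean_space. norm z)"
  using integrable_gauss_power_norm[of 1] by simp

subsection \<open>Gaussian averaging and Lipschitz functions\<close>

lemma measure_gauss_UNIV [simp]: "measure gauss (UNIV :: 'a::euclidean_space set) = 1"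
  using gauss.prob_space[where 'a='a] by simp

lemma distr_gauss_rotate:
  assumes a: "0 < a" and ab: "a\<^sup>2 + b\<^sup>2 = 1"
  shows "distr (gauss \<Otimes>\<^sub>M gauss) borel (\<lambda>(y, x). a *\<^sub>R x + b *\<^sub>R y) = (gauss :: 'a::euclidean_space measure)"
proof (rule measure_eqI)
  fix S :: "'a set" assume "S \<in> sets (distr (gauss \<Otimes>\<^sub>M gauss) borel (\<lambda>(y, x). a *\<^sub>R x + b *\<^sub>R y))"
  then have [measurable]: "S \<in> sets borel" by simp
  have "emeasure (distr (gauss \<Otimes>\<^sub>M gauss) borel (\<lambda>(y, x). a *\<^sub>R x + b *\<^sub>R y)) S
      = (\<integral>\<^sup>+p. indicator S (a *\<^sub>R snd p + b *\<^sub>R fst p) \<partial>(gauss \<Otimes>\<^sub>M gauss))"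
    by (subst nn_integral_indicator[symmetric], simp, subst nn_integral_distr)
      (auto simp: case_prod_beta)
  also have "\<dots> = (\<integral>\<^sup>+y. \<integral>\<^sup>+x. indicator S (a *\<^sub>R x + b *\<^sub>R y) \<partial>gauss \<partial>gauss)"
    by (subst gauss.nn_integral_fst[symmetric]) auto
  also have "\<dots> = emeasure gauss S"
    by (subst nn_integral_gauss_rotate) (use assms in auto)
  finally show "emeasure (distr (gauss \<Otimes>\<^sub>M gauss) borel (\<lambda>(y, x). a *\<^sub>R x + b *\<^sub>R y)) S = emeasure gauss S" .
qed simp

lemma integral_gauss_rotate:
  fixes f :: "'a::euclidean_space \<Rightarrow> real"
  assumes a: "0 \<le> a" and b: "0 \<le> b" and ab: "a\<^sup>2 + b\<^sup>2 = 1" and f: "integrable gauss f"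
  shows "(\<integral>y. \<integral>x. f (a *\<^sub>R x + b *\<^sub>R y) \<partial>gauss \<partial>gauss) = (\<integral>u. f u \<partial>gauss)"
proof (cases "a = 0")
  \<comment> \<open>The rotation lemma divides by \<open>a\<close>, so this case is separate; here
    \<open>b = 1\<close> and both sides coincide.\<close>
  case True
  then have "b = 1" using b ab by (simp add: power2_eq_1_iff)
  then show ?thesis using True by simp
next
  case False
  interpret gauss_pair: pair_sigma_finite "gauss :: 'a measure" "gauss :: 'a measure" ..
  have [measurable]: "f \<in> borel_measurable borel"
    using borel_measurable_integrable[OF f] by simp
  let ?r = "\<lambda>(y, x). a *\<^sub>R x + b *\<^sub>R y :: 'a"
  have d: "distr (gauss \<Otimes>\<^sub>M gauss) borel ?r = gauss"
    by (rule distr_gauss_rotate) (use a ab False in auto)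
  have "integrable (gauss \<Otimes>\<^sub>M gauss) (\<lambda>p. f (?r p))"
    by (subst integrable_distr_eq[symmetric, where g="?r" and N=borel]) (auto simp: d f)
  then have "(\<integral>y. \<integral>x. f (a *\<^sub>R x + b *\<^sub>R y) \<partial>gauss \<partial>gauss) = (\<integral>p. f (?r p) \<partial>(gauss \<Otimes>\<^sub>M gauss))"
    by (subst gauss_pair.integral_fst'[symmetric]) auto
  also have "\<dots> = (\<integral>u. f u \<partial>distr (gauss \<Otimes>\<^sub>M gauss) borel ?r)"
    by (rule integral_distr[symmetric]) auto
  finally show ?thesis by (simp add: d)
qed

text \<open>The heat semigroup, indexed by standard deviation instead of time, so that composition
  adds the squares of the indices. Values in a Banach space allow it to act on gradients as
  well.\<close>

definition heat :: "real \<Rightarrow> ('a::euclidean_space \<Rightarrow> 'b::{banach, second_countable_topology}) \<Rightarrow> 'a \<Rightarrow> 'b" where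
  "heat c f x = (\<integral>z. f (x + c *\<^sub>R z) \<partial>gauss)"

lemma heat_0 [simp]: "heat 0 f = f"
  by (simp add: heat_def fun_eq_iff)

lemma borel_measurable_heat [measurable]:
  assumes [measurable]: "f \<in> borel_measurable borel"
  shows "heat c f \<in> borel_measurable borel"
  unfolding heat_def by measurable

text \<open>The sum of independent Gaussians of deviations \<open>a\<close> and \<open>b\<close> is
  a Gaussian of deviation \<open>c\<close>: rotation invariance with the coefficients b / c and a /
  c.\<close>

lemma heat_heat:
  fixes f :: "'a::euclidean_space \<Rightarrow> real"
  assumes a: "0 \<le> a" and b: "0 \<le> b" and c: "0 < c" "c\<^sup>2 = a\<^sup>2 + b\<^sup>2"
    and f: "integrable gauss (\<lambda>z. f (x + c *\<^sub>R z))"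
  shows "heat a (heat b f) x = heat c f x"
proof -
  have "(b / c)\<^sup>2 + (a / c)\<^sup>2 = 1"
    unfolding power_divide add_divide_distrib[symmetric] using c(1) by (simp add: add.commute[of "b\<^sup>2"] c(2)[symmetric])
  from integral_gauss_rotate[OF _ _ this f] show ?thesis
    using a b c by (simp add: heat_def scaleR_add_right algebra_simps)
qed

lemma norm_integral_gauss_le:
  fixes g :: "'a::euclidean_space \<Rightarrow> 'b::{banach, second_countable_topology}"
  assumes "\<And>z. norm (g z) \<le> B"
  shows "norm (\<integral>z. g z \<partial>gauss) \<le> B"
proof (cases "integrable gauss g")
  case True
  have "norm (\<integral>z. g z \<partial>gauss) \<le> (\<integral>z. norm (g z) \<partial>gauss)"
    by (rule integral_norm_bound)
  also have "\<dots> \<le> (\<integral>z. B \<partial>(gauss :: 'a measure))"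
    by (rule integral_mono) (use True assms in auto)
  finally show ?thesis by simp
next
  \<comment> \<open>The integral is then 0 by convention, and \<open>B\<close> is nonnegative
    because it bounds a norm.\<close>
  case False
  then show ?thesis
    using order_trans[OF norm_ge_zero assms] by (simp add: not_integrable_integral_eq)
qed

section \<open>Exponential moments of smooth Lipschitz functions by small steps\<close>

lemma exp_le_cubic:
  "exp (x::real) \<le> 1 + x + x\<^sup>2 / 2 + \<bar>x\<bar> ^ 3 * exp \<bar>x\<bar>"
proof -
  obtain t where t: "\<bar>t\<bar> \<le> \<bar>x\<bar>" "exp x = (\<Sum>m<3. x ^ m / fact m) + exp t / fact 3 * x ^ 3"
    using Maclaurin_exp_le[of x 3] by blast
  \<comment> \<open>The cubic remainder may be estimated crudely, as it enters only at third order
    in the step size. The coefficient 1/2 of the square stays exact and produces the sharp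
    constant.\<close>
  have "exp t / fact 3 * x ^ 3 \<le> exp t / fact 3 * \<bar>x\<bar> ^ 3"
    by (intro mult_left_mono) (use abs_ge_self[of "x ^ 3"] in \<open>auto simp: power_abs\<close>)
  also have "\<dots> \<le> exp \<bar>x\<bar> * \<bar>x\<bar> ^ 3"
  proof (intro mult_right_mono)
    have "exp t / fact 3 \<le> exp t" by (simp add: fact_numeral)
    also have "\<dots> \<le> exp \<bar>x\<bar>" using t(1) by simp
    finally show "exp t / fact 3 \<le> exp \<bar>x\<bar>" .
  qed simp
  finally have "exp t / fact 3 * x ^ 3 \<le> \<bar>x\<bar> ^ 3 * exp \<bar>x\<bar>"
    by (simp only: mult.commute)
  then show ?thesis
    using t(2) by (simp add: numeral_3_eq_3 power2_eq_square)
qed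

text \<open>\<open>G\<close> plays the gradient of \<open>f\<close>. Bounds on increments replace
  differentiability, since such bounds pass through an integral directly.\<close>

locale smooth_lipschitz =
  fixes f :: "'a::euclidean_space \<Rightarrow> real" and G :: "'a \<Rightarrow> 'a" and L K :: real
  assumes borel_measurable_gradient [measurable]: "G \<in> borel_measurable borel"
    and norm_gradient: "norm (G x) \<le> L"
    and lipschitz: "\<bar>f (x + z) - f x\<bar> \<le> L * norm z"
    and taylor: "\<bar>f (x + z) - f x - G x \<bullet> z\<bar> \<le> K * (norm z)\<^sup>2"
begin

lemma L_nonneg: "0 \<le> L"
  using norm_ge_zero norm_gradient by (rule order_trans)

lemma K_nonneg: "0 \<le> K"
proof -
  obtain b :: 'a where "b \<in> Basis" using nonempty_Basis by blast
  then show ?thesis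
    using order_trans[OF abs_ge_zero taylor[of 0 b]] by simp
qed

lemma borel_measurable_f [measurable]: "f \<in> borel_measurable borel"
proof -
  have "L-lipschitz_on UNIV f"
  proof (rule lipschitz_onI)
    fix x y show "dist (f x) (f y) \<le> L * dist x y"
      using lipschitz[of y "x - y"] by (simp add: dist_norm)
  qed (rule L_nonneg)
  then show ?thesis
    by (intro borel_measurable_continuous_onI lipschitz_on_continuous_on)
qed

lemma integrable_shift: "integrable gauss (\<lambda>z. f (x + c *\<^sub>R z))"
proof (rule Bochner_Integration.integrable_bound)
  show "integrable gauss (\<lambda>z::'a. \<bar>f x\<bar> + L * \<bar>c\<bar> * norm z)"
    by (intro Bochner_Integration.integrable_add integrable_mult_right integrable_gauss_norm) simp
  show "AE z in gauss. norm (f (x + c *\<^sub>R z)) \<le> norm (\<bar>f x\<bar> + L * \<bar>c\<bar> * norm z)"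
    using lipschitz[of x "c *\<^sub>R z" for z] L_nonneg
    by (intro AE_I2) (smt (verit) norm_scaleR mult.assoc mult_nonneg_nonneg norm_ge_zero real_norm_def)
qed simp

lemma integrable_exp_shift: "integrable gauss (\<lambda>z. exp (f (x + c *\<^sub>R z)))"
proof (rule Bochner_Integration.integrable_bound)
  show "integrable gauss (\<lambda>z::'a. exp (f x) * exp ((L * \<bar>c\<bar>) * norm z))"
    by (intro integrable_mult_right integrable_gauss_exp_norm)
  show "AE z in gauss. norm (exp (f (x + c *\<^sub>R z))) \<le> norm (exp (f x) * exp ((L * \<bar>c\<bar>) * norm z))"
  proof (rule AE_I2)
    fix z
    show "norm (exp (f (x + c *\<^sub>R z))) \<le> norm (exp (f x) * exp ((L * \<bar>c\<bar>) * norm z))"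
      using lipschitz[of x "c *\<^sub>R z"] by (simp add: exp_add[symmetric] abs_le_iff)
  qed
qed simp

lemma integrable_gradient_shift: "integrable gauss (\<lambda>z. G (x + c *\<^sub>R z))"
  by (rule gauss.integrable_const_bound[of _ L]) (auto simp: norm_gradient)

text \<open>An increment of \<open>heat c f\<close> is the average of increments of \<open>f\<close>
  at shifted points, so the pointwise bounds carry over with unchanged constants.\<close>

lemma smooth_lipschitz_heat: "smooth_lipschitz (heat c f) (heat c G) L K"
proof
  show "heat c G \<in> borel_measurable borel"
    by measurable
  show "norm (heat c G x) \<le> L" for x
    unfolding heat_def by (rule norm_integral_gauss_le) (rule norm_gradient)
  show "\<bar>heat c f (x + z) - heat c f x\<bar> \<le> L * norm z" for x z
  proof -
    have "heat c f (x + z) - heat c f x = (\<integral>w. f ((x + c *\<^sub>R w) + z) - f (x + c *\<^sub>R w) \<partial>gauss)"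
      unfolding heat_def
      by (subst Bochner_Integration.integral_diff)
        (use integrable_shift[of "x + z" c] integrable_shift[of x c] in \<open>auto simp: add_ac\<close>)
    also have "norm \<dots> \<le> L * norm z"
      by (rule norm_integral_gauss_le) (use lipschitz in simp)
    finally show ?thesis by simp
  qed
  show "\<bar>heat c f (x + z) - heat c f x - heat c G x \<bullet> z\<bar> \<le> K * (norm z)\<^sup>2" for x z
  proof -
    have "heat c f (x + z) - heat c f x - heat c G x \<bullet> z
        = (\<integral>w. f ((x + c *\<^sub>R w) + z) - f (x + c *\<^sub>R w) - G (x + c *\<^sub>R w) \<bullet> z \<partial>gauss)"
      unfolding heat_def
      by (subst Bochner_Integration.integral_diff Bochner_Integration.integral_diff integral_inner_left;
          (subst Bochner_Integration.integral_diff)?)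
        (use integrable_shift[of "x + z" c] integrable_shift[of x c] integrable_gradient_shift
          in \<open>auto simp: add_ac\<close>)
    also have "norm \<dots> \<le> K * (norm z)\<^sup>2"
      by (rule norm_integral_gauss_le) (use taylor in simp)
    finally show ?thesis by simp
  qed
qed

end

text \<open>Collects the terms of third order in the step size in the expansion of the exponential moment of one step.
  It depends on \<open>f\<close> only through \<open>L\<close> and \<open>K\<close>, which averaging preserves, so one constant serves all steps.\<close>

definition step_error :: "real \<Rightarrow> real \<Rightarrow> 'a::euclidean_space \<Rightarrow> real" where
  "step_error L K z =
    (let m1 = \<integral>w. norm w \<partial>(gauss :: 'a measure); m2 = \<integral>w. (norm w)\<^sup>2 \<partial>(gauss :: 'a measure)
     in K * ((norm z)\<^sup>2 + m2) * (L * (2 * norm z + m1)) / 2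
      + (L * (norm z + m1)) ^ 3 * exp (L * (norm z + m1)))"

lemma integrable_step_error: "integrable gauss (step_error L K :: 'a::euclidean_space \<Rightarrow> real)"
proof -
  define m1 where "m1 = (\<integral>w. norm w \<partial>(gauss :: 'a measure))"
  define m2 where "m2 = (\<integral>w. (norm w)\<^sup>2 \<partial>(gauss :: 'a measure))"
  \<comment> \<open>The error expanded into powers of \<open>norm z\<close>, alone or times
    \<open>exp (L * norm z)\<close>, with the constant \<open>exp (L * m1)\<close> pulled
    out.\<close>
  have "integrable gauss (\<lambda>z::'a.
      K * L * norm z ^ 3 + K * L * m1 / 2 * norm z ^ 2 + K * L * m2 * norm z ^ 1 + K * L * m1 * m2 / 2
      + L ^ 3 * exp (L * m1) * (norm z ^ 3 * exp (L * norm z) + 3 * m1 * (norm z ^ 2 * exp (L * norm z))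
        + 3 * m1\<^sup>2 * (norm z ^ 1 * exp (L * norm z)) + m1 ^ 3 * exp (L * norm z)))"
    by (intro Bochner_Integration.integrable_add integrable_mult_right integrable_gauss_power_norm
        integrable_gauss_power_exp_norm integrable_gauss_exp_norm) simp
  also have "(\<lambda>z::'a.
      K * L * norm z ^ 3 + K * L * m1 / 2 * norm z ^ 2 + K * L * m2 * norm z ^ 1 + K * L * m1 * m2 / 2
      + L ^ 3 * exp (L * m1) * (norm z ^ 3 * exp (L * norm z) + 3 * m1 * (norm z ^ 2 * exp (L * norm z))
        + 3 * m1\<^sup>2 * (norm z ^ 1 * exp (L * norm z)) + m1 ^ 3 * exp (L * norm z))) = step_error L K"
    unfolding step_error_def Let_def m1_def[symmetric] m2_def[symmetric]
    by (rule ext) (simp add: distrib_left exp_add, simp add: field_simps power3_eq_cube power2_eq_square)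
  finally show ?thesis .
qed

context smooth_lipschitz
begin

text \<open>The first-order term \<open>X z\<close> is kept exactly because its mean is 0. Its
  square is replaced by the square of the linear part e (G x \<bullet> z), at a cost of order e^3,
  and the cubic remainder has the same order.\<close>

lemma exp_centered_le:
  fixes x z :: 'a
  assumes e: "0 \<le> e" "e \<le> 1"
  defines "X \<equiv> \<lambda>z. f (x + e *\<^sub>R z) - heat e f x"
  shows "exp (X z) \<le> 1 + X z + e\<^sup>2 * (G x \<bullet> z)\<^sup>2 / 2 + e ^ 3 * step_error L K z"
proof -
  define m1 where "m1 = (\<integral>w. norm w \<partial>(gauss :: 'a measure))"
  define m2 where "m2 = (\<integral>w. (norm w)\<^sup>2 \<partial>(gauss :: 'a measure))"
  define r where "r w = f (x + e *\<^sub>R w) - f x - e * (G x \<bullet> w)" for w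
  have m1: "0 \<le> m1" and m2: "0 \<le> m2" by (simp_all add: m1_def m2_def)
  note int = integrable_shift[of x e] integrable_gauss_norm integrable_gauss_power_norm[of 2]
    has_bochner_integral_gauss_inner[of "G x", unfolded has_bochner_integral_iff]
  have int_r: "integrable gauss r"
    unfolding r_def using int by auto
  have r: "\<bar>r w\<bar> \<le> e\<^sup>2 * K * (norm w)\<^sup>2" for w
    using taylor[of x "e *\<^sub>R w"] e by (simp add: r_def power_mult_distrib mult_ac)
  \<comment> \<open>The linear term has mean 0, so only the Taylor remainder \<open>r\<close> moves
    the mean away from \<open>f x\<close>.\<close>
  have mean: "heat e f x = f x + (\<integral>w. r w \<partial>gauss)"
    unfolding r_def heat_def using int by simp
  have "\<bar>\<integral>w. r w \<partial>gauss\<bar> \<le> (\<integral>w. \<bar>r w\<bar> \<partial>gauss)"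
    by (rule integral_abs_bound)
  also have "\<dots> \<le> (\<integral>w. e\<^sup>2 * K * (norm w)\<^sup>2 \<partial>(gauss :: 'a measure))"
    by (rule integral_mono) (use int_r int r in auto)
  finally have mr: "\<bar>\<integral>w. r w \<partial>gauss\<bar> \<le> e\<^sup>2 * K * m2"
    by (simp add: m2_def)
  define s where "s = X z - e * (G x \<bullet> z)"
  have "s = r z - (\<integral>w. r w \<partial>gauss)"
    by (simp add: s_def X_def mean r_def)
  then have s: "\<bar>s\<bar> \<le> e\<^sup>2 * (K * ((norm z)\<^sup>2 + m2))"
    using r[of z] mr by (simp add: algebra_simps)
  have "\<bar>heat e f x - f x\<bar> \<le> (\<integral>w. e * L * norm w \<partial>(gauss :: 'a measure))"
  proof -
    have "\<bar>heat e f x - f x\<bar> = \<bar>\<integral>w. f (x + e *\<^sub>R w) - f x \<partial>gauss\<bar>"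
      using int by (simp add: heat_def)
    also have "\<dots> \<le> (\<integral>w. \<bar>f (x + e *\<^sub>R w) - f x\<bar> \<partial>gauss)"
      by (rule integral_abs_bound)
    also have "\<dots> \<le> (\<integral>w. e * L * norm w \<partial>(gauss :: 'a measure))"
    proof (rule integral_mono)
      show "\<bar>f (x + e *\<^sub>R w) - f x\<bar> \<le> e * L * norm w" for w
        using lipschitz[of x "e *\<^sub>R w"] e by (simp add: mult_ac)
    qed (use int in auto)
    finally show ?thesis .
  qed
  then have "\<bar>heat e f x - f x\<bar> \<le> e * L * m1"
    by (simp add: m1_def)
  moreover have "\<bar>f (x + e *\<^sub>R z) - f x\<bar> \<le> e * L * norm z"
    using lipschitz[of x "e *\<^sub>R z"] e by (simp add: mult_ac)
  ultimately have X: "\<bar>X z\<bar> \<le> e * (L * (norm z + m1))"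
    by (simp add: X_def algebra_simps)
  have Gz: "\<bar>e * (G x \<bullet> z)\<bar> \<le> e * (L * norm z)"
    using Cauchy_Schwarz_ineq2[of "G x" z] mult_right_mono[OF norm_gradient norm_ge_zero, of x z] e
    by (simp add: abs_mult mult_left_mono)
  \<comment> \<open>Difference of squares: the factor \<open>s\<close> is of order e^2 and the other
    of order e.\<close>
  have "(X z)\<^sup>2 - (e * (G x \<bullet> z))\<^sup>2 = s * (X z + e * (G x \<bullet> z))"
    by (simp add: s_def power2_eq_square algebra_simps)
  also have "\<dots> \<le> \<bar>s\<bar> * \<bar>X z + e * (G x \<bullet> z)\<bar>"
    by (metis abs_ge_self abs_mult)
  also have "\<dots> \<le> (e\<^sup>2 * (K * ((norm z)\<^sup>2 + m2))) * (e * (L * (2 * norm z + m1)))"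
  proof (rule mult_mono[OF s])
    show "\<bar>X z + e * (G x \<bullet> z)\<bar> \<le> e * (L * (2 * norm z + m1))"
      using X Gz by (simp add: algebra_simps)
  qed (use K_nonneg m2 in auto)
  also have "\<dots> = e ^ 3 * (K * ((norm z)\<^sup>2 + m2) * (L * (2 * norm z + m1)))"
    by (simp add: power2_eq_square power3_eq_cube)
  finally have sq: "(X z)\<^sup>2 \<le> e\<^sup>2 * (G x \<bullet> z)\<^sup>2 + e ^ 3 * (K * ((norm z)\<^sup>2 + m2) * (L * (2 * norm z + m1)))"
    by (simp add: power_mult_distrib)
  have B: "0 \<le> L * (norm z + m1)" using L_nonneg m1 by simp
  \<comment> \<open>Here \<open>e \<le> 1\<close> makes the bound inside the exponential independent
    of the step size.\<close>
  have "\<bar>X z\<bar> \<le> L * (norm z + m1)"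
    using X mult_right_mono[OF e(2) B] by simp
  then have "\<bar>X z\<bar> ^ 3 * exp \<bar>X z\<bar> \<le> (e * (L * (norm z + m1))) ^ 3 * exp (L * (norm z + m1))"
    by (intro mult_mono power_mono X) (use e B in auto)
  then have cube: "\<bar>X z\<bar> ^ 3 * exp \<bar>X z\<bar> \<le> e ^ 3 * ((L * (norm z + m1)) ^ 3 * exp (L * (norm z + m1)))"
    by (simp only: power_mult_distrib[of e] mult.assoc)
  have "e ^ 3 * step_error L K z = e ^ 3 * (K * ((norm z)\<^sup>2 + m2) * (L * (2 * norm z + m1))) / 2
      + e ^ 3 * ((L * (norm z + m1)) ^ 3 * exp (L * (norm z + m1)))"
    unfolding step_error_def Let_def m1_def[symmetric] m2_def[symmetric]
    by (simp only: distrib_left times_divide_eq_right)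
  then show ?thesis
    using exp_le_cubic[of "X z"] sq cube by linarith
qed

text \<open>Integrating the pointwise expansion removes the linear term and turns the quadratic one
  into \<open>(norm (G x))\<^sup>2\<close>, at most \<open>L\<^sup>2\<close>; then 1 + t \<le> exp
  t.\<close>

lemma heat_exp_step:
  assumes e: "0 \<le> e" "e \<le> 1"
  shows "heat e (\<lambda>y. exp (f y)) x
    \<le> exp (heat e f x + (e\<^sup>2 * L\<^sup>2 / 2 + e ^ 3 * (\<integral>z. step_error L K z \<partial>(gauss :: 'a measure))))"
proof -
  define E where "E = (\<integral>z. step_error L K z \<partial>(gauss :: 'a measure))"
  let ?X = "\<lambda>z. f (x + e *\<^sub>R z) - heat e f x"
  have "integrable gauss (\<lambda>z. exp (f (x + e *\<^sub>R z)) * exp (- heat e f x))"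
    by (intro integrable_mult_left integrable_exp_shift)
  then have intX: "integrable gauss (\<lambda>z. exp (?X z))"
    by (simp add: exp_diff exp_minus field_simps)
  have const: "has_bochner_integral gauss (\<lambda>_::'a. 1::real) 1"
    and X: "has_bochner_integral gauss ?X 0"
    and err: "has_bochner_integral gauss (step_error L K :: 'a \<Rightarrow> real) E"
    using integrable_shift[of x e] by (simp_all add: has_bochner_integral_iff heat_def E_def integrable_step_error)
  have rhs: "has_bochner_integral gauss (\<lambda>z. 1 + ?X z + e\<^sup>2 * (G x \<bullet> z)\<^sup>2 / 2 + e ^ 3 * step_error L K z)
      (1 + 0 + e\<^sup>2 * (norm (G x))\<^sup>2 / 2 + e ^ 3 * E)"
    by (intro has_bochner_integral_add has_bochner_integral_divide has_bochner_integral_mult_right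
        const X err has_bochner_integral_gauss_inner_sq)
  have "heat e (\<lambda>y. exp (f y)) x = exp (heat e f x) * (\<integral>z. exp (?X z) \<partial>gauss)"
    unfolding heat_def[of e "\<lambda>y. exp (f y)"]
    by (subst Bochner_Integration.integral_mult_right_zero[symmetric]) (simp add: exp_add[symmetric])
  also have "(\<integral>z. exp (?X z) \<partial>gauss)
      \<le> (\<integral>z. 1 + ?X z + e\<^sup>2 * (G x \<bullet> z)\<^sup>2 / 2 + e ^ 3 * step_error L K z \<partial>gauss)"
    by (rule integral_mono[OF intX integrable.intros[OF rhs] exp_centered_le[OF e]])
  also have "\<dots> = 1 + e\<^sup>2 * (norm (G x))\<^sup>2 / 2 + e ^ 3 * E"
    using has_bochner_integral_integral_eq[OF rhs] by simp
  also have "\<dots> \<le> 1 + (e\<^sup>2 * L\<^sup>2 / 2 + e ^ 3 * E)"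
    using mult_left_mono[OF power_mono[OF norm_gradient norm_ge_zero, of x 2], of "e\<^sup>2"] by simp
  also have "\<dots> \<le> exp (e\<^sup>2 * L\<^sup>2 / 2 + e ^ 3 * E)"
    by (rule exp_ge_add_one_self)
  finally show ?thesis
    by (simp add: E_def exp_add)
qed

end

text \<open>The k increments of size \<open>e\<close> together have deviation
  \<open>sqrt (real k) * e\<close>. In the induction one increment is split off on the outside, and
  the one-step bound applies to \<open>heat b f\<close>, which has the same constants as
  \<open>f\<close>.\<close>

lemma heat_exp_iterate:
  fixes f :: "'a::euclidean_space \<Rightarrow> real"
  assumes f: "smooth_lipschitz f G L K" and e: "0 < e" "e \<le> 1"
  shows "heat (sqrt (real k) * e) (\<lambda>y. exp (f y)) x
    \<le> exp (heat (sqrt (real k) * e) f x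
        + real k * (e\<^sup>2 * L\<^sup>2 / 2 + e ^ 3 * (\<integral>z. step_error L K z \<partial>(gauss :: 'a measure))))"
proof (induction k arbitrary: x)
  case (Suc k)
  define d where "d = e\<^sup>2 * L\<^sup>2 / 2 + e ^ 3 * (\<integral>z. step_error L K z \<partial>(gauss :: 'a measure))"
  define b c where "b = sqrt (real k) * e" and "c = sqrt (real (Suc k)) * e"
  interpret f: smooth_lipschitz f G L K by fact
  interpret h: smooth_lipschitz "heat b f" "heat b G" L K by (rule f.smooth_lipschitz_heat)
  have abc: "0 \<le> e" "0 \<le> b" "0 < c" "c\<^sup>2 = e\<^sup>2 + b\<^sup>2"
    using e by (simp_all add: b_def c_def power_mult_distrib algebra_simps)
  have IH: "heat b (\<lambda>y. exp (f y)) y \<le> exp (real k * d) * exp (heat b f y)" for y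
    using Suc.IH[of y] unfolding b_def[symmetric] d_def[symmetric] by (simp add: exp_add mult.commute)
  have "heat c (\<lambda>y. exp (f y)) x = heat e (heat b (\<lambda>y. exp (f y))) x"
    by (rule heat_heat[OF abc f.integrable_exp_shift, symmetric])
  also have "\<dots> \<le> heat e (\<lambda>y. exp (real k * d) * exp (heat b f y)) x"
    unfolding heat_def[of e]
  proof (rule integral_mono)
    show int: "integrable gauss (\<lambda>z. exp (real k * d) * exp (heat b f (x + e *\<^sub>R z)))"
      by (intro integrable_mult_right h.integrable_exp_shift)
    show "integrable gauss (\<lambda>z. heat b (\<lambda>y. exp (f y)) (x + e *\<^sub>R z))"
    proof (rule Bochner_Integration.integrable_bound[OF int])
      show "AE z in gauss. norm (heat b (\<lambda>y. exp (f y)) (x + e *\<^sub>R z))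
          \<le> norm (exp (real k * d) * exp (heat b f (x + e *\<^sub>R z)))"
      proof (rule AE_I2)
        fix z
        have "0 \<le> heat b (\<lambda>y. exp (f y)) (x + e *\<^sub>R z)"
          by (simp add: heat_def)
        then show "norm (heat b (\<lambda>y. exp (f y)) (x + e *\<^sub>R z))
            \<le> norm (exp (real k * d) * exp (heat b f (x + e *\<^sub>R z)))"
          using IH[of "x + e *\<^sub>R z"] by simp
      qed
    qed measurable
  qed (rule IH)
  also have "\<dots> = exp (real k * d) * heat e (\<lambda>y. exp (heat b f y)) x"
    by (simp add: heat_def)
  also have "\<dots> \<le> exp (real k * d) * exp (heat e (heat b f) x + d)"
    using h.heat_exp_step[of e x] e by (simp add: d_def)
  also have "heat e (heat b f) x = heat c f x"
    by (rule heat_heat[OF abc f.integrable_shift])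
  finally show ?case
    unfolding c_def[symmetric] d_def[symmetric]
    by (simp add: exp_add[symmetric] algebra_simps)
qed simp

lemma (in smooth_lipschitz) gauss_exp_le:
  "(\<integral>z. exp (f z) \<partial>gauss) \<le> exp ((\<integral>z. f z \<partial>gauss) + L\<^sup>2 / 2)"
proof -
  define E where "E = (\<integral>z. step_error L K z \<partial>(gauss :: 'a measure))"
  have bound: "(\<integral>z. exp (f z) \<partial>gauss) \<le> exp ((\<integral>z. f z \<partial>gauss) + (L\<^sup>2 / 2 + E / sqrt (real (Suc n))))" for n
  proof -
    \<comment> \<open>N steps of size 1 / sqrt N have total variance 1. Their second-order terms add
      up to \<open>L\<^sup>2 / 2\<close> and their third-order terms to
      \<open>E / sqrt (real N)\<close>.\<close>
    define N where "N = Suc n"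
    define e where "e = 1 / sqrt (real N)"
    have e: "0 < e" "e \<le> 1" "sqrt (real N) * e = 1" "real N * e\<^sup>2 = 1"
      by (simp_all add: e_def N_def power_divide)
    have "real N * (e\<^sup>2 * L\<^sup>2 / 2 + e ^ 3 * E) = (real N * e\<^sup>2) * (L\<^sup>2 / 2 + E * e)"
      by (simp add: algebra_simps power3_eq_cube power2_eq_square)
    also have "\<dots> = L\<^sup>2 / 2 + E / sqrt (real N)"
      unfolding e(4) by (simp add: e_def)
    finally show ?thesis
      using heat_exp_iterate[OF smooth_lipschitz_axioms e(1,2), of N 0]
      unfolding e(3) E_def[symmetric] by (simp add: heat_def N_def)
  qed
  have "(\<lambda>n. E / sqrt (real (Suc n))) \<longlonglongrightarrow> 0"
    by real_asymp
  then have "(\<lambda>n. exp ((\<integral>z. f z \<partial>gauss) + (L\<^sup>2 / 2 + E / sqrt (real (Suc n)))))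
      \<longlonglongrightarrow> exp ((\<integral>z. f z \<partial>gauss) + (L\<^sup>2 / 2 + 0))"
    by (intro tendsto_intros)
  then show ?thesis
    using bound by (intro LIMSEQ_le_const[where X="\<lambda>n. exp ((\<integral>z. f z \<partial>gauss) + (L\<^sup>2 / 2 + E / sqrt (real (Suc n))))"]) auto
qed

subsection \<open>Gaussian tail bounds\<close>

text \<open>The Chernoff bound, from indicator \<le> exp; the tilt and the threshold are absorbed
  into \<open>g\<close>.\<close>

lemma measure_gauss_pos_le:
  assumes g: "integrable gauss (\<lambda>z::'a::euclidean_space. exp (g z))" and [measurable]: "g \<in> borel_measurable borel"
  shows "measure gauss {z. 0 < g z} \<le> (\<integral>z. exp (g z) \<partial>gauss)"
proof -
  have [measurable]: "{z. 0 < g z} \<in> sets borel"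
    by measurable
  have "measure gauss {z. 0 < g z} = (\<integral>z. indicator {z. 0 < g z} z \<partial>gauss)"
    by simp
  also have "\<dots> \<le> (\<integral>z. exp (g z) \<partial>gauss)"
  proof (rule integral_mono[OF _ g])
    show "integrable gauss (indicator {z. 0 < g z} :: 'a \<Rightarrow> real)"
      by (rule gauss.integrable_const_bound[of _ 1]) auto
  qed (auto simp: indicator_def)
  finally show ?thesis .
qed

lemma has_bochner_integral_gauss_exp_inner:
  "has_bochner_integral gauss (\<lambda>z. exp (a \<bullet> z)) (exp ((norm a)\<^sup>2 / 2))"
  by (rule has_bochner_integral_nn_integral) (auto simp: nn_integral_gauss_exp_inner)

lemma gauss_inner_upper_tail:
  fixes a :: "'a::euclidean_space"
  assumes a: "norm a \<le> \<sigma>" and s: "0 \<le> s"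
  shows "measure gauss {z. s * \<sigma> < a \<bullet> z} \<le> exp (- s\<^sup>2 / 2)"
proof (cases "\<sigma> = 0")
  \<comment> \<open>Then \<open>a\<close> is 0 and the event, defined by a strict inequality, is
    empty.\<close>
  case True
  then show ?thesis using a by simp
next
  case False
  then have \<sigma>: "0 < \<sigma>" using order_trans[OF norm_ge_zero a] by simp
  \<comment> \<open>The tilt s / \<sigma> is optimal for a Gaussian of deviation \<sigma> at level s
    \<sigma>; the exponent becomes at most s^2 / 2 - s^2.\<close>
  define b where "b = (s / \<sigma>) *\<^sub>R a"
  have "norm b \<le> s"
    using mult_left_mono[OF a, of "s / \<sigma>"] s \<sigma> by (simp add: b_def)
  then have b: "(norm b)\<^sup>2 \<le> s\<^sup>2"
    by (rule power_mono) simp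
  have exp_b: "has_bochner_integral gauss (\<lambda>z. exp (b \<bullet> z - s\<^sup>2)) (exp ((norm b)\<^sup>2 / 2) / exp (s\<^sup>2))"
    unfolding exp_diff by (intro has_bochner_integral_divide has_bochner_integral_gauss_exp_inner)
  \<comment> \<open>For \<open>s = 0\<close> the tilt vanishes and the inclusion can fail, but then
    the claimed bound is 1.\<close>
  have "measure gauss {z. s * \<sigma> < a \<bullet> z} \<le> measure gauss {z. 0 < b \<bullet> z - s\<^sup>2} \<or> s = 0"
  proof (cases "s = 0")
    case False
    then have "0 < s / \<sigma>" using s \<sigma> by simp
    then have "s * \<sigma> < a \<bullet> z \<Longrightarrow> (s / \<sigma>) * (s * \<sigma>) < b \<bullet> z" for z
      unfolding b_def inner_scaleR_left by (rule mult_strict_left_mono[rotated])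
    then have "{z. s * \<sigma> < a \<bullet> z} \<subseteq> {z. 0 < b \<bullet> z - s\<^sup>2}"
      using \<sigma> by (auto simp: power2_eq_square)
    then show ?thesis
      by (intro disjI1 gauss.finite_measure_mono) auto
  qed simp
  moreover have "measure gauss {z. 0 < b \<bullet> z - s\<^sup>2} \<le> exp ((norm b)\<^sup>2 / 2) / exp (s\<^sup>2)"
    using measure_gauss_pos_le[of "\<lambda>z. b \<bullet> z - s\<^sup>2"] exp_b
    by (simp add: has_bochner_integral_iff)
  moreover have "exp ((norm b)\<^sup>2 / 2) / exp (s\<^sup>2) \<le> exp (- s\<^sup>2 / 2)"
    using b by (simp add: exp_diff[symmetric])
  ultimately show ?thesis
    by auto
qed

text \<open>Union bound: the threshold satisfies s^2 \<ge> 2 q + \<beta>^2, so the factor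
  \<open>exp q\<close> for the number of vectors cancels and the factor in \<beta> remains.\<close>

lemma gauss_finite_upper_tail:
  fixes a :: "'i \<Rightarrow> 'a::euclidean_space"
  assumes I: "finite I" "real (card I) \<le> exp q" and a: "\<And>i. i \<in> I \<Longrightarrow> norm (a i) \<le> \<sigma>"
    and q: "0 \<le> q" and \<beta>: "0 \<le> \<beta>"
  shows "measure gauss {z. \<exists>i\<in>I. (sqrt (2 * q) + \<beta>) * \<sigma> < a i \<bullet> z} \<le> exp (- \<beta>\<^sup>2 / 2)"
proof -
  define s where "s = sqrt (2 * q) + \<beta>"
  have s: "0 \<le> s" using q \<beta> by (simp add: s_def)
  have [measurable]: "{z. s * \<sigma> < a i \<bullet> z} \<in> sets borel" for i
    by measurable
  have "{z. \<exists>i\<in>I. s * \<sigma> < a i \<bullet> z} = (\<Union>i\<in>I. {z. s * \<sigma> < a i \<bullet> z})"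
    by auto
  then have "measure gauss {z. \<exists>i\<in>I. s * \<sigma> < a i \<bullet> z} \<le> (\<Sum>i\<in>I. measure gauss {z. s * \<sigma> < a i \<bullet> z})"
    using gauss.finite_measure_subadditive_finite[OF I(1), of "\<lambda>i. {z. s * \<sigma> < a i \<bullet> z}"] by (auto simp: image_subset_iff)
  also have "\<dots> \<le> (\<Sum>i\<in>I. exp (- s\<^sup>2 / 2))"
    by (intro sum_mono gauss_inner_upper_tail a s)
  also have "\<dots> \<le> exp q * exp (- s\<^sup>2 / 2)"
    using I(2) by (simp add: mult_right_mono)
  also have "\<dots> \<le> exp (- \<beta>\<^sup>2 / 2)"
  proof -
    have "2 * q + \<beta>\<^sup>2 \<le> s\<^sup>2"
      using q \<beta> by (simp add: s_def power2_sum)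
    then show ?thesis by (simp add: exp_add[symmetric])
  qed
  finally show ?thesis by (simp add: s_def)
qed

section \<open>The smoothed absolute value\<close>

definition smooth_abs :: "real \<Rightarrow> real \<Rightarrow> real" where
  "smooth_abs d t = sqrt (t\<^sup>2 + d\<^sup>2)"

lemma abs_le_smooth_abs: "\<bar>t\<bar> \<le> smooth_abs d t"
  unfolding smooth_abs_def by (rule real_le_rsqrt) simp

lemma smooth_abs_le: "0 \<le> d \<Longrightarrow> smooth_abs d t \<le> \<bar>t\<bar> + d"
  unfolding smooth_abs_def using sqrt_add_le_add_sqrt[of "t\<^sup>2" "d\<^sup>2"] by simp

lemma smooth_abs_ge: "d \<le> smooth_abs d t"
  unfolding smooth_abs_def by (rule real_le_rsqrt) simp

lemma smooth_abs_sq: "(smooth_abs d t)\<^sup>2 = t\<^sup>2 + d\<^sup>2"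
  by (simp add: smooth_abs_def)

lemma borel_measurable_smooth_abs [measurable]: "smooth_abs d \<in> borel_measurable borel"
  unfolding smooth_abs_def by measurable

text \<open>Multiplying the difference by the sum of the two square roots rationalizes it. The slope
  \<open>w\<close> is exhibited explicitly so that the slopes of several summands can serve as
  weights in one vector sum.\<close>

lemma smooth_abs_diff:
  assumes "0 < d"
  obtains w where "\<bar>w\<bar> \<le> 1" "smooth_abs d (t + s) - smooth_abs d t = w * s"
proof
  define p q where "p = smooth_abs d t" and "q = smooth_abs d (t + s)"
  have pq: "0 < p + q"
    using smooth_abs_ge[of d t] smooth_abs_ge[of d "t + s"] assms by (simp add: p_def q_def)
  have "\<bar>2 * t + s\<bar> \<le> p + q"
    using abs_le_smooth_abs[of t d] abs_le_smooth_abs[of "t + s" d] by (simp add: p_def q_def)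
  then show "\<bar>(2 * t + s) / (p + q)\<bar> \<le> 1"
    using pq by (simp add: abs_divide)
  have "p\<^sup>2 = t\<^sup>2 + d\<^sup>2" "q\<^sup>2 = (t + s)\<^sup>2 + d\<^sup>2"
    by (simp_all add: p_def q_def smooth_abs_sq)
  then have "(q - p) * (p + q) = (2 * t + s) * s"
    by (simp add: power2_eq_square algebra_simps)
  then show "smooth_abs d (t + s) - smooth_abs d t = (2 * t + s) / (p + q) * s"
    using pq unfolding p_def[symmetric] q_def[symmetric] by (simp add: nonzero_eq_divide_eq)
qed

lemma smooth_abs_taylor:
  assumes "0 < d"
  shows "\<bar>smooth_abs d (t + s) - smooth_abs d t - t / smooth_abs d t * s\<bar> \<le> s\<^sup>2 / (2 * d)"
proof -
  define p q where "p = smooth_abs d t" and "q = smooth_abs d (t + s)"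
  have p: "d \<le> p" "0 < p" and q: "0 < q"
    using smooth_abs_ge[of d t] smooth_abs_ge[of d "t + s"] assms by (simp_all add: p_def q_def)
  have sq: "p\<^sup>2 = t\<^sup>2 + d\<^sup>2" "q\<^sup>2 = (t + s)\<^sup>2 + d\<^sup>2"
    by (simp_all add: p_def q_def smooth_abs_sq)
  \<comment> \<open>Cauchy-Schwarz for the vectors (t, d) and (t + s, d), of lengths
    \<open>p\<close> and \<open>q\<close>. It places the tangent line below the graph.\<close>
  have "(t * (t + s) + d\<^sup>2)\<^sup>2 \<le> (p * q)\<^sup>2"
  proof -
    have "(p * q)\<^sup>2 - (t * (t + s) + d\<^sup>2)\<^sup>2 = (d * s)\<^sup>2"
      unfolding power_mult_distrib sq by (simp add: power2_eq_square algebra_simps)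
    then show ?thesis using zero_le_power2[of "d * s"] by linarith
  qed
  then have "t * (t + s) + d\<^sup>2 \<le> p * q"
    by (rule power2_le_imp_le) (use p q in simp)
  then have "p * p + t * s \<le> p * q"
    using sq(1) by (simp add: power2_eq_square algebra_simps)
  then have lower: "0 \<le> q - p - t / p * s"
    using p by (simp add: field_simps)
  \<comment> \<open>The upper estimate: after multiplication by 2 p, this inequality leaves exactly
    \<open>s\<^sup>2\<close>.\<close>
  have "2 * p * q \<le> p\<^sup>2 + q\<^sup>2"
    by (rule sum_squares_bound)
  then have "2 * p * (q - p - t / p * s) \<le> s\<^sup>2"
    using p sq by (simp add: power2_eq_square algebra_simps)
  then have "q - p - t / p * s \<le> s\<^sup>2 / (2 * p)"
    using p by (simp add: field_simps)
  also have "\<dots> \<le> s\<^sup>2 / (2 * d)"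
    using p assms by (intro divide_left_mono) auto
  finally show ?thesis
    using lower by (simp add: p_def q_def)
qed

text \<open>Increments and gradient are both weighted sums of the vectors \<open>a i\<close> with
  weights in [-1, 1], so \<open>L\<close> controls both, uniformly in \<open>d\<close>. Only the
  Taylor constant grows as \<open>d\<close> shrinks.\<close>

lemma smooth_lipschitz_smooth_abs:
  fixes a :: "'i \<Rightarrow> 'a::euclidean_space"
  assumes L: "\<And>w. (\<And>i. i \<in> I \<Longrightarrow> \<bar>w i\<bar> \<le> 1) \<Longrightarrow> norm (\<Sum>i\<in>I. w i *\<^sub>R a i) \<le> L" and d: "0 < d"
  shows "smooth_lipschitz (\<lambda>z. c * (\<Sum>i\<in>I. smooth_abs d (a i \<bullet> z)))
    (\<lambda>z. c *\<^sub>R (\<Sum>i\<in>I. (a i \<bullet> z / smooth_abs d (a i \<bullet> z)) *\<^sub>R a i))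
    (\<bar>c\<bar> * L) (\<bar>c\<bar> * (\<Sum>i\<in>I. (norm (a i))\<^sup>2 / (2 * d)))"
proof
  show "(\<lambda>z. c *\<^sub>R (\<Sum>i\<in>I. (a i \<bullet> z / smooth_abs d (a i \<bullet> z)) *\<^sub>R a i)) \<in> borel_measurable borel"
    by measurable
  have "\<bar>t / smooth_abs d t\<bar> \<le> 1" for t
    using abs_le_smooth_abs[of t d] smooth_abs_ge[of d t] d by (simp add: abs_divide)
  then show "norm (c *\<^sub>R (\<Sum>i\<in>I. (a i \<bullet> x / smooth_abs d (a i \<bullet> x)) *\<^sub>R a i)) \<le> \<bar>c\<bar> * L" for x
    unfolding norm_scaleR by (intro mult_left_mono L) auto
  show "\<bar>c * (\<Sum>i\<in>I. smooth_abs d (a i \<bullet> (x + z))) - c * (\<Sum>i\<in>I. smooth_abs d (a i \<bullet> x))\<bar> \<le> \<bar>c\<bar> * L * norm z"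
    for x z
  proof -
    have "\<exists>w. \<bar>w\<bar> \<le> 1 \<and> smooth_abs d (a i \<bullet> x + a i \<bullet> z) - smooth_abs d (a i \<bullet> x) = w * (a i \<bullet> z)" for i
      using smooth_abs_diff[OF d, of "a i \<bullet> x" "a i \<bullet> z"] by metis
    then obtain w where w: "\<And>i. \<bar>w i\<bar> \<le> 1"
      "\<And>i. smooth_abs d (a i \<bullet> x + a i \<bullet> z) - smooth_abs d (a i \<bullet> x) = w i * (a i \<bullet> z)"
      by metis
    have "(\<Sum>i\<in>I. smooth_abs d (a i \<bullet> (x + z))) - (\<Sum>i\<in>I. smooth_abs d (a i \<bullet> x)) = (\<Sum>i\<in>I. w i *\<^sub>R a i) \<bullet> z"
      by (simp add: sum_subtractf[symmetric] inner_add_right w(2) inner_sum_left)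
    also have "\<bar>\<dots>\<bar> \<le> norm (\<Sum>i\<in>I. w i *\<^sub>R a i) * norm z"
      by (rule Cauchy_Schwarz_ineq2)
    also have "\<dots> \<le> L * norm z"
      by (intro mult_right_mono L w(1)) simp
    finally show ?thesis
      by (simp add: right_diff_distrib[symmetric] abs_mult mult.assoc mult_left_mono)
  qed
  show "\<bar>c * (\<Sum>i\<in>I. smooth_abs d (a i \<bullet> (x + z))) - c * (\<Sum>i\<in>I. smooth_abs d (a i \<bullet> x))
      - (c *\<^sub>R (\<Sum>i\<in>I. (a i \<bullet> x / smooth_abs d (a i \<bullet> x)) *\<^sub>R a i)) \<bullet> z\<bar>
      \<le> \<bar>c\<bar> * (\<Sum>i\<in>I. (norm (a i))\<^sup>2 / (2 * d)) * (norm z)\<^sup>2" for x z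
  proof -
    let ?t = "\<lambda>i. smooth_abs d (a i \<bullet> x + a i \<bullet> z) - smooth_abs d (a i \<bullet> x)
      - a i \<bullet> x / smooth_abs d (a i \<bullet> x) * (a i \<bullet> z)"
    have "c * (\<Sum>i\<in>I. smooth_abs d (a i \<bullet> (x + z))) - c * (\<Sum>i\<in>I. smooth_abs d (a i \<bullet> x))
      - (c *\<^sub>R (\<Sum>i\<in>I. (a i \<bullet> x / smooth_abs d (a i \<bullet> x)) *\<^sub>R a i)) \<bullet> z = c * (\<Sum>i\<in>I. ?t i)"
      by (simp add: sum_subtractf inner_add_right inner_sum_left right_diff_distrib)
    also have "\<bar>\<dots>\<bar> \<le> \<bar>c\<bar> * (\<Sum>i\<in>I. (norm (a i))\<^sup>2 / (2 * d) * (norm z)\<^sup>2)"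
      unfolding abs_mult
    proof (intro mult_left_mono order_trans[OF sum_abs] sum_mono)
      fix i
      have "\<bar>?t i\<bar> \<le> (a i \<bullet> z)\<^sup>2 / (2 * d)"
        by (rule smooth_abs_taylor[OF d])
      also have "\<dots> \<le> (norm (a i) * norm z)\<^sup>2 / (2 * d)"
        using power_mono[OF Cauchy_Schwarz_ineq2[of "a i" z], of 2] d by (intro divide_right_mono) auto
      finally show "\<bar>?t i\<bar> \<le> (norm (a i))\<^sup>2 / (2 * d) * (norm z)\<^sup>2"
        by (simp add: power_mult_distrib)
    qed simp
    finally show ?thesis
      by (simp only: sum_distrib_right mult.assoc)
  qed
qed

text \<open>The bound for the smoothed sum involves \<open>L\<close> but not the Taylor constant, so
  \<open>d\<close> may tend to 0; smoothing changes the sum by at most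
  \<open>card I * d\<close>.\<close>

lemma gauss_exp_neg_sum_abs_le:
  fixes a :: "'i \<Rightarrow> 'a::euclidean_space"
  assumes L: "\<And>w. (\<And>i. i \<in> I \<Longrightarrow> \<bar>w i\<bar> \<le> 1) \<Longrightarrow> norm (\<Sum>i\<in>I. w i *\<^sub>R a i) \<le> L" and c: "0 \<le> c"
  shows "(\<integral>z. exp (- c * (\<Sum>i\<in>I. \<bar>a i \<bullet> z\<bar>)) \<partial>gauss)
    \<le> exp (- c * (sqrt (2 / pi) * (\<Sum>i\<in>I. norm (a i))) + c\<^sup>2 * L\<^sup>2 / 2)"
proof -
  let ?f = "\<lambda>z. \<Sum>i\<in>I. \<bar>a i \<bullet> z\<bar>"
  let ?g = "\<lambda>d z. \<Sum>i\<in>I. smooth_abs d (a i \<bullet> z)"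
  have f: "has_bochner_integral gauss ?f (sqrt (2 / pi) * (\<Sum>i\<in>I. norm (a i)))"
    unfolding sum_distrib_left
    by (intro has_bochner_integral_sum has_bochner_integral_gauss_abs_inner)
  have le: "?f z \<le> ?g d z" "0 < d \<Longrightarrow> ?g d z \<le> ?f z + card I * d" for d :: real and z
    using sum_mono[of I "\<lambda>i. smooth_abs d (a i \<bullet> z)" "\<lambda>i. \<bar>a i \<bullet> z\<bar> + d"] smooth_abs_le[of d]
    by (auto intro!: sum_mono abs_le_smooth_abs simp: sum.distrib)
  have bound: "(\<integral>z. exp (- c * ?f z) \<partial>gauss)
      \<le> exp (- c * (sqrt (2 / pi) * (\<Sum>i\<in>I. norm (a i))) + c\<^sup>2 * L\<^sup>2 / 2 + c * card I * d)" if d: "0 < d" for d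
  proof -
    interpret smooth_lipschitz "\<lambda>z. (- c) * ?g d z"
      "\<lambda>z. (- c) *\<^sub>R (\<Sum>i\<in>I. (a i \<bullet> z / smooth_abs d (a i \<bullet> z)) *\<^sub>R a i)"
      "\<bar>- c\<bar> * L" "\<bar>- c\<bar> * (\<Sum>i\<in>I. (norm (a i))\<^sup>2 / (2 * d))"
      by (rule smooth_lipschitz_smooth_abs[OF L d])
    have int: "integrable gauss (\<lambda>z. exp (- c * ?g d z))" "integrable gauss (\<lambda>z. - c * ?g d z)"
      using integrable_exp_shift[of 0 1] integrable_shift[of 0 1] by simp_all
    have "(\<integral>z. exp (- c * ?f z) \<partial>gauss) \<le> (\<integral>z. exp (c * card I * d) * exp (- c * ?g d z) \<partial>gauss)"
    proof (rule integral_mono')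
      show "exp (- c * ?f z) \<le> exp (c * card I * d) * exp (- c * ?g d z)" for z
        using mult_left_mono[OF le(2)[OF d] c] by (simp add: exp_add[symmetric] algebra_simps)
    qed (use int in auto)
    also have "\<dots> = exp (c * card I * d) * (\<integral>z. exp (- c * ?g d z) \<partial>gauss)"
      by simp
    also have "\<dots> \<le> exp (c * card I * d) * exp ((\<integral>z. - c * ?g d z \<partial>gauss) + (\<bar>- c\<bar> * L)\<^sup>2 / 2)"
      by (intro mult_left_mono gauss_exp_le) simp
    \<comment> \<open>Smoothing only increases the sum, so in the mean it may be undone at no
      cost.\<close>
    also have "(\<integral>z. - c * ?g d z \<partial>gauss) \<le> (\<integral>z. - c * ?f z \<partial>gauss)"
      by (rule integral_mono[OF int(2)])
        (use f c le(1) in \<open>auto simp: has_bochner_integral_iff intro!: mult_left_mono\<close>)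
    also have "\<dots> = - c * (sqrt (2 / pi) * (\<Sum>i\<in>I. norm (a i)))"
      using f by (intro has_bochner_integral_integral_eq has_bochner_integral_mult_right)
    finally show ?thesis
      by (simp add: exp_add[symmetric] power_mult_distrib add_ac)
  qed
  have lim: "(\<lambda>n. exp (- c * (sqrt (2 / pi) * (\<Sum>i\<in>I. norm (a i))) + c\<^sup>2 * L\<^sup>2 / 2 + c * card I * (1 / real (Suc n))))
      \<longlonglongrightarrow> exp (- c * (sqrt (2 / pi) * (\<Sum>i\<in>I. norm (a i))) + c\<^sup>2 * L\<^sup>2 / 2 + c * card I * 0)"
    by (intro tendsto_intros LIMSEQ_Suc[OF lim_const_over_n])
  have "(\<integral>z. exp (- c * ?f z) \<partial>gauss)
      \<le> exp (- c * (sqrt (2 / pi) * (\<Sum>i\<in>I. norm (a i))) + c\<^sup>2 * L\<^sup>2 / 2 + c * card I * 0)"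
    by (rule LIMSEQ_le_const[OF lim]) (intro exI allI impI bound, simp)
  then show ?thesis by simp
qed

lemma gauss_sum_abs_lower_tail:
  fixes a :: "'i \<Rightarrow> 'a::euclidean_space"
  assumes L: "\<And>w. (\<And>i. i \<in> I \<Longrightarrow> \<bar>w i\<bar> \<le> 1) \<Longrightarrow> norm (\<Sum>i\<in>I. w i *\<^sub>R a i) \<le> L" and I: "finite I"
    and \<beta>: "0 \<le> \<beta>"
  shows "measure gauss {z. (\<Sum>i\<in>I. \<bar>a i \<bullet> z\<bar>) < sqrt (2 / pi) * (\<Sum>i\<in>I. norm (a i)) - \<beta> * L} \<le> exp (- \<beta>\<^sup>2 / 2)"
proof (cases "L = 0")
  \<comment> \<open>Weights concentrated on one index show that every \<open>a i\<close> is 0, and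
    the event is empty.\<close>
  case True
  have "a i = 0" if "i \<in> I" for i
  proof -
    have "(\<Sum>j\<in>I. (if j = i then 1 else 0) *\<^sub>R a j) = a i"
      using that I by (simp add: if_distrib[of "\<lambda>c. c *\<^sub>R _"] sum.delta cong: if_cong)
    then show ?thesis using L[of "\<lambda>j. if j = i then 1 else 0"] True by simp
  qed
  then show ?thesis using True by simp
next
  case False
  let ?f = "\<lambda>z. \<Sum>i\<in>I. \<bar>a i \<bullet> z\<bar>"
  define m where "m = sqrt (2 / pi) * (\<Sum>i\<in>I. norm (a i))"
  have "0 \<le> L" using L[of "\<lambda>_. 0"] by simp
  then have L0: "0 < L" using False by simp
  show ?thesis
  proof (cases "\<beta> = 0")
    case True
    then show ?thesis by simp
  next
    case False
    \<comment> \<open>The minimizer of - c \<beta> L + c^2 L^2 / 2, with minimum - \<beta>^2 /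
      2.\<close>
    define c where "c = \<beta> / L"
    have c: "0 < c" "c * L = \<beta>" using \<beta> False L0 by (simp_all add: c_def)
    let ?h = "\<lambda>z. - c * ?f z + (c * m - \<beta>\<^sup>2)"
    have int: "integrable gauss (\<lambda>z. exp (- c * ?f z))"
      by (rule gauss.integrable_const_bound[of _ 1]) (use c in \<open>auto intro!: AE_I2 mult_nonneg_nonneg sum_nonneg\<close>)
    have "?f z < m - \<beta> * L \<Longrightarrow> c * ?f z < c * m - \<beta>\<^sup>2" for z
      using mult_strict_left_mono[of "?f z" "m - \<beta> * L" c] c
      by (simp add: right_diff_distrib power2_eq_square mult.left_commute)
    moreover have int_h: "integrable gauss (\<lambda>z. exp (?h z))"
      unfolding exp_add by (intro integrable_mult_left int)
    ultimately have "measure gauss {z. ?f z < m - \<beta> * L} \<le> measure gauss {z. 0 < ?h z}"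
      by (intro gauss.finite_measure_mono) auto
    also have "\<dots> \<le> (\<integral>z. exp (?h z) \<partial>gauss)"
      by (rule measure_gauss_pos_le[OF int_h]) measurable
    also have "\<dots> = (\<integral>z. exp (- c * ?f z) \<partial>gauss) * exp (c * m - \<beta>\<^sup>2)"
      unfolding exp_add by simp
    also have "\<dots> \<le> exp (- c * m + c\<^sup>2 * L\<^sup>2 / 2) * exp (c * m - \<beta>\<^sup>2)"
      unfolding m_def by (intro mult_right_mono gauss_exp_neg_sum_abs_le L) (use c in auto)
    also have "\<dots> = exp (- \<beta>\<^sup>2 / 2)"
      by (simp add: exp_add[symmetric] power_mult_distrib[symmetric] c(2))
    finally show ?thesis by (simp add: m_def)
  qed
qed

subsection \<open>The norms and constants of a matrix\<close>

text \<open>The classical bound (e N / k)^k: weight the term for size j by (N / k)^(k - j) \<ge> 1,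
  extend the sum to all j \<le> N, and apply the binomial theorem and (1 + k / N)^N \<le> exp
  k.\<close>

lemma card_subsets_le:
  assumes A: "finite A" and k: "1 \<le> k" "k \<le> card A"
  shows "real (card {U. U \<subseteq> A \<and> card U \<le> k}) \<le> exp (real k * (1 + ln (real (card A) / real k)))"
proof -
  define N where "N = card A"
  have N: "0 < real k" "0 < real N" using k by (simp_all add: N_def)
  have "{U. U \<subseteq> A \<and> card U \<le> k} = (\<Union>j\<le>k. {U. U \<subseteq> A \<and> card U = j})"
    by auto
  then have "card {U. U \<subseteq> A \<and> card U \<le> k} \<le> (\<Sum>j\<le>k. N choose j)"
    using card_UN_le[of "{..k}" "\<lambda>j. {U. U \<subseteq> A \<and> card U = j}"] A by (simp add: n_subsets N_def)
  then have "real (card {U. U \<subseteq> A \<and> card U \<le> k}) \<le> (\<Sum>j\<le>k. real (N choose j))"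
    by (metis of_nat_le_iff of_nat_sum)
  also have "\<dots> \<le> (\<Sum>j\<le>k. real (N choose j) * ((real N / real k) ^ k * (real k / real N) ^ j))"
  proof (intro sum_mono)
    fix j assume "j \<in> {..k}"
    then have "(real N / real k) ^ k * (real k / real N) ^ j = (real N / real k) ^ (k - j)"
      using N by (simp add: power_diff power_divide)
    moreover have "1 \<le> (real N / real k) ^ (k - j)"
      using N k by (intro one_le_power) (simp add: N_def)
    ultimately show "real (N choose j) \<le> real (N choose j) * ((real N / real k) ^ k * (real k / real N) ^ j)"
      using mult_left_mono[of 1 _ "real (N choose j)"] by simp
  qed
  also have "\<dots> \<le> (\<Sum>j\<le>N. real (N choose j) * ((real N / real k) ^ k * (real k / real N) ^ j))"
    by (rule sum_mono2) (use k in \<open>auto simp: N_def\<close>)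
  also have "\<dots> = (real N / real k) ^ k * (real k / real N + 1) ^ N"
    by (simp add: binomial_ring sum_distrib_left mult_ac)
  also have "\<dots> \<le> (real N / real k) ^ k * exp (real k / real N) ^ N"
    using exp_ge_add_one_self[of "real k / real N"] by (intro mult_left_mono power_mono) (auto simp: add.commute)
  also have "exp (real k / real N) ^ N = exp (real k)"
    using N by (simp add: exp_of_nat_mult[symmetric])
  also have "(real N / real k) ^ k = exp (real k * ln (real N / real k))"
    using N by (simp add: exp_of_nat_mult)
  finally show ?thesis
    by (simp add: N_def exp_add[symmetric] distrib_left add.commute)
qed

text \<open>Common elements cancel. The least value on \<open>T - S\<close> separates the values
  there from those on \<open>S - T\<close>, which has no more elements.\<close>

lemma sum_le_sum_largest:
  fixes f :: "'a \<Rightarrow> real"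
  assumes fin: "finite S" "finite T" and card: "card S \<le> card T" and f: "\<And>i. 0 \<le> f i"
    and T: "\<And>i j. i \<in> T \<Longrightarrow> j \<notin> T \<Longrightarrow> f j \<le> f i"
  shows "sum f S \<le> sum f T"
proof -
  have le: "card (S - T) \<le> card (T - S)"
    using card_Diff_subset_Int[of S T] card_Diff_subset_Int[of T S] card fin by (simp add: Int_commute)
  have "sum f (S - T) \<le> sum f (T - S)"
  proof (cases "T - S = {}")
    case True
    have "S - T = {}" using le fin unfolding True by simp
    then show ?thesis using True by (simp only: sum.empty)
  next
    case False
    define c where "c = Min (f ` (T - S))"
    have "c \<in> f ` (T - S)"
      unfolding c_def using False fin by (intro Min_in) auto
    then have c: "0 \<le> c" "\<And>j. j \<in> S - T \<Longrightarrow> f j \<le> c"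
      using f T by auto
    have "sum f (S - T) \<le> real (card (S - T)) * c"
      by (rule sum_bounded_above) (rule c(2))
    also have "\<dots> \<le> real (card (T - S)) * c"
      using le c(1) by (simp add: mult_right_mono)
    also have "\<dots> \<le> sum f (T - S)"
      by (rule sum_bounded_below) (use fin in \<open>simp add: c_def\<close>)
    finally show ?thesis .
  qed
  then show ?thesis
    using sum.Int_Diff[OF fin(1), of f T] sum.Int_Diff[OF fin(2), of f S] by (simp add: Int_commute)
qed

text \<open>The norm is the largest sum over at most \<open>k\<close> indices, attained at the top
  \<open>k\<close>. The form with a bound \<open>c\<close> serves both for estimating the norm and
  for the measurability of the final event.\<close>

lemma k1_norm_le_iff:
  fixes x :: "real ^ 'n"
  assumes k: "k \<le> CARD('n)"
  shows "k1_norm k x \<le> c \<longleftrightarrow> (\<forall>S. card S \<le> k \<longrightarrow> (\<Sum>i\<in>S. \<bar>x $ i\<bar>) \<le> c)"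
proof -
  let ?f = "\<lambda>i. \<bar>x $ i\<bar>"
  obtain xs :: "'n list" where xs: "set xs = UNIV" "distinct xs"
    using finite_distinct_list[OF finite] by blast
  \<comment> \<open>Indices rather than values are sorted, so that ties leave a genuine set of
    \<open>k\<close> indices.\<close>
  define ys where "ys = sort_key ?f xs"
  have ys: "set ys = UNIV" "distinct ys" "sorted (map ?f ys)"
    by (simp_all add: ys_def xs)
  define T where "T = set (take k (rev ys))"
  have "{#?f i. i \<in># mset_set UNIV#} = mset (map ?f ys)"
    by (metis ys(1,2) mset_set_set mset_map)
  then have "sorted_list_of_multiset {#?f i. i \<in># mset_set UNIV#} = map ?f ys"
    by (simp only: sorted_list_of_multiset_mset sorted_sort_id[OF ys(3)])
  then have "k1_norm k x = sum_list (map ?f (take k (rev ys)))"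
    by (simp add: k1_norm_def rev_map take_map)
  then have k1: "k1_norm k x = sum ?f T"
    using ys(2) by (simp add: T_def sum_list_distinct_conv_sum_set)
  have "length ys = CARD('n)"
    using distinct_card[OF ys(2)] ys(1) by simp
  then have card_T: "card T = k"
    using k ys(2) by (simp add: T_def distinct_card)
  have "sorted_wrt (\<lambda>i j. ?f j \<le> ?f i) (take k (rev ys) @ drop k (rev ys))"
    using ys(3) by (simp add: sorted_wrt_rev sorted_wrt_map)
  then have "\<And>i j. i \<in> T \<Longrightarrow> j \<in> set (drop k (rev ys)) \<Longrightarrow> ?f j \<le> ?f i"
    unfolding sorted_wrt_append T_def by blast
  moreover have "j \<notin> T \<Longrightarrow> j \<in> set (drop k (rev ys))" for j
  proof -
    have "set (take k (rev ys)) \<union> set (drop k (rev ys)) = UNIV"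
      by (metis append_take_drop_id set_append set_rev ys(1))
    then show "j \<notin> T \<Longrightarrow> j \<in> set (drop k (rev ys))"
      by (auto simp: T_def)
  qed
  ultimately have "card S \<le> k \<Longrightarrow> sum ?f S \<le> sum ?f T" for S
    by (intro sum_le_sum_largest) (auto simp: card_T)
  then show ?thesis
    using card_T k1 by (metis order_trans order_refl)
qed

section \<open>The constants of the matrix as bounds on norms\<close>

lemma finite_vec_entries:
  fixes A :: "real set"
  assumes "finite A"
  shows "finite {v :: real ^ 'n. \<forall>i. v $ i \<in> A}"
proof (rule finite_subset)
  show "{v :: real ^ 'n. \<forall>i. v $ i \<in> A} \<subseteq> vec_lambda ` (\<Pi>\<^sub>E i\<in>UNIV. A)"
  proof
    fix v :: "real ^ 'n" assume "v \<in> {v. \<forall>i. v $ i \<in> A}"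
    then show "v \<in> vec_lambda ` (\<Pi>\<^sub>E i\<in>UNIV. A)"
      by (intro image_eqI[of _ _ "vec_nth v"]) (auto simp: PiE_iff)
  qed
  show "finite (vec_lambda ` (\<Pi>\<^sub>E i\<in>(UNIV :: 'n set). A))"
    using assms by (intro finite_imageI finite_PiE) auto
qed

lemma vector_matrix_mult_rows:
  "v v* F = (\<Sum>i\<in>UNIV. v $ i *\<^sub>R row i F)" for F :: "real ^ 'm ^ 'n"
  by (simp add: vec_eq_iff vector_matrix_mult_def row_def mult.commute)

lemma norm_signed_rows_le:
  fixes F :: "real ^ 'm ^ 'n"
  assumes v: "\<forall>i. v $ i \<in> {-1, 1}"
  shows "norm (v v* F) \<le> L_const F"
proof -
  let ?Q = "\<lambda>v. v \<bullet> ((F ** transpose F) *v v)"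
  have "{?Q v | v. \<forall>i. v $ i \<in> {-1, 1}} = ?Q ` {v. \<forall>i. v $ i \<in> {-1, 1}}"
    by auto
  then have "finite {?Q v | v. \<forall>i. v $ i \<in> {-1, 1}}"
    by (simp only:) (intro finite_imageI finite_vec_entries, simp)
  then have "?Q v \<le> L_sq F"
    unfolding L_sq_def using v by (intro Max_ge) auto
  moreover have "?Q v = (norm (v v* F))\<^sup>2"
    by (simp add: power2_norm_eq_inner matrix_vector_mul_assoc[symmetric] dot_lmul_matrix[symmetric])
  ultimately show ?thesis
    unfolding L_const_def by (intro real_le_rsqrt) simp
qed

text \<open>A convex function on a cube is largest at a vertex. A suitable vertex is explicit:
  \<open>v\<close> collects the signs of the inner products of the rows with the weighted sum
  \<open>g\<close> itself.\<close>

lemma norm_weighted_rows_le: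
  fixes F :: "real ^ 'm ^ 'n"
  assumes w: "\<And>i. \<bar>w i\<bar> \<le> 1"
  shows "norm (\<Sum>i\<in>UNIV. w i *\<^sub>R row i F) \<le> L_const F"
proof -
  define g where "g = (\<Sum>i\<in>UNIV. w i *\<^sub>R row i F)"
  define v :: "real ^ 'n" where "v = (\<chi> i. if 0 \<le> row i F \<bullet> g then 1 else - 1)"
  have "norm g * norm g = (\<Sum>i\<in>UNIV. w i * (row i F \<bullet> g))"
    by (subst (2) g_def) (simp add: norm_eq_sqrt_inner g_def[symmetric] inner_sum_left[symmetric] flip: inner_scaleR_left)
  also have "\<dots> \<le> (\<Sum>i\<in>UNIV. v $ i * (row i F \<bullet> g))"
  proof (intro sum_mono)
    fix i
    have "w i * (row i F \<bullet> g) \<le> \<bar>w i\<bar> * \<bar>row i F \<bullet> g\<bar>"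
      by (metis abs_ge_self abs_mult)
    also have "\<dots> \<le> 1 * \<bar>row i F \<bullet> g\<bar>"
      by (intro mult_right_mono w) simp
    finally show "w i * (row i F \<bullet> g) \<le> v $ i * (row i F \<bullet> g)"
      by (auto simp: v_def)
  qed
  also have "\<dots> = (v v* F) \<bullet> g"
    by (simp add: vector_matrix_mult_rows inner_sum_left)
  also have "\<dots> \<le> norm (v v* F) * norm g"
    by (rule norm_cauchy_schwarz)
  also have "\<dots> \<le> L_const F * norm g"
    by (intro mult_right_mono norm_signed_rows_le) (auto simp: v_def)
  finally have "norm g \<le> L_const F \<or> g = 0"
    by (auto simp: mult_le_cancel_right)
  moreover have "0 \<le> L_const F"
    using order_trans[OF norm_ge_zero norm_signed_rows_le[of v F]] by (auto simp: v_def)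
  ultimately show ?thesis
    by (auto simp: g_def[symmetric])
qed

text \<open>The set \<open>U\<close> encodes the 0/1 vector (u_+, u_-), so the candidates are
  counted as subsets of a set with 2n elements.\<close>

definition selected_rows :: "real ^ 'm ^ 'n \<Rightarrow> (2 \<times> 'n) set \<Rightarrow> real ^ 'm" where
  "selected_rows F U = ((\<chi> i. of_bool ((1, i) \<in> U)) - (\<chi> i. of_bool ((2, i) \<in> U))) v* F"

lemma norm_selected_rows_le:
  fixes F :: "real ^ 'm ^ 'n"
  assumes U: "card U \<le> k"
  shows "norm (selected_rows F U) \<le> sigma_const k F"
proof -
  let ?Q = "\<lambda>u. u \<bullet> (kronecker (vector [vector [1, -1], vector [-1, 1]] :: real ^ 2 ^ 2)
                (F ** transpose F) *v u)"
  let ?C = "\<lambda>u :: real ^ (2 \<times> 'n). (\<forall>p. u $ p \<in> {0, 1}) \<and> (\<Sum>p\<in>UNIV. u $ p) \<le> real k"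
  define u :: "real ^ (2 \<times> 'n)" where "u = (\<chi> p. of_bool (p \<in> U))"
  have u: "?C u"
    using U by (simp add: u_def sum.If_cases of_bool_def)
  have "{?Q u | u. ?C u} \<subseteq> ?Q ` {u. \<forall>p. u $ p \<in> {0, 1}}"
    by auto
  then have "finite {?Q u | u. ?C u}"
    using finite_vec_entries[of "{0, 1}"] by (rule finite_subset[OF _ finite_imageI]) simp
  then have "?Q u \<le> sigma_sq k F"
    unfolding sigma_sq_def using u by (intro Max_ge) auto
  then have "(norm (selected_rows F U))\<^sup>2 \<le> sigma_sq k F"
    unfolding kron_quadratic by (simp add: selected_rows_def u_def)
  then show ?thesis
    unfolding sigma_const_def by (rule real_le_rsqrt)
qed

lemma k1_norm_selected_rows:
  fixes F :: "real ^ 'm ^ 'n"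
  assumes k: "k \<le> CARD('n)" and le: "\<And>U. card U \<le> k \<Longrightarrow> selected_rows F U \<bullet> z \<le> c"
  shows "k1_norm k (F *v z) \<le> c"
  unfolding k1_norm_le_iff[OF k]
proof (intro allI impI)
  fix S :: "'n set" assume S: "card S \<le> k"
  let ?x = "F *v z"
  \<comment> \<open>Each index of \<open>S\<close> goes to the block given by the sign of its
    coefficient, so that the signed sum becomes a sum of magnitudes.\<close>
  define U :: "(2 \<times> 'n) set" where "U = (\<lambda>i. (if 0 \<le> ?x $ i then 1 else 2, i)) ` S"
  have ne: "(1::2) \<noteq> 2" by simp
  have U: "((1, i) \<in> U) = (i \<in> S \<and> 0 \<le> ?x $ i)" "((2, i) \<in> U) = (i \<in> S \<and> ?x $ i < 0)" for i
  proof -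
    have "(c, i) \<in> U \<longleftrightarrow> i \<in> S \<and> c = (if 0 \<le> ?x $ i then 1 else 2)" for c
      by (auto simp: U_def)
    then show "((1, i) \<in> U) = (i \<in> S \<and> 0 \<le> ?x $ i)" "((2, i) \<in> U) = (i \<in> S \<and> ?x $ i < 0)"
      using ne by (auto simp: not_le)
  qed
  have "selected_rows F U \<bullet> z = ((\<chi> i. of_bool ((1, i) \<in> U)) - (\<chi> i. of_bool ((2, i) \<in> U))) \<bullet> ?x"
    by (simp add: selected_rows_def dot_lmul_matrix)
  also have "\<dots> = (\<Sum>i\<in>UNIV. if i \<in> S then \<bar>?x $ i\<bar> else 0)"
    unfolding inner_vec_def by (intro sum.cong) (auto simp: U)
  also have "\<dots> = (\<Sum>i\<in>S. \<bar>?x $ i\<bar>)"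
    by (simp add: sum.If_cases)
  finally have "(\<Sum>i\<in>S. \<bar>?x $ i\<bar>) = selected_rows F U \<bullet> z" ..
  also have "\<dots> \<le> c"
    using card_image_le[of S "\<lambda>i. (if 0 \<le> ?x $ i then 1 else 2 :: 2, i)"] S by (intro le) (simp add: U_def)
  finally show "(\<Sum>i\<in>S. \<bar>?x $ i\<bar>) \<le> c" .
qed

section \<open>The probability of the condition\<close>

lemma l1_norm_rows: "l1_norm (F *v z) = (\<Sum>i\<in>UNIV. \<bar>row i F \<bullet> z\<bar>)" for F :: "real ^ 'm ^ 'n"
  by (simp add: l1_norm_def matrix_vector_mult_def row_def inner_vec_def)

lemma std_gaussian_density_eq: "std_gaussian_density = gauss_density"
  by (simp add: fun_eq_iff std_gaussian_density_def gauss_density_def)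

theorem proposition2p4:
  fixes F :: "real ^ 'm ^ 'n" and k :: nat and \<alpha> \<beta> :: real
    and M :: "'a measure" and y :: "'a \<Rightarrow> real ^ 'm"
  assumes "1 \<le> k" and "k \<le> CARD('n)"
    and "0 \<le> \<alpha>" and "0 < \<beta>"
    and "(sqrt (2 * real k * (1 + ln (2 * real CARD('n) / real k))) + \<beta>) * sigma_const k F
         \<le> (sqrt (2 / pi) * (\<Sum>i\<in>UNIV. norm (row i F)) - \<beta> * L_const F) * \<alpha>"
    and "prob_space M"
    and "distributed M lborel y (\<lambda>z. ennreal (std_gaussian_density z))"
  shows "measure M {\<omega> \<in> space M. k1_norm k (F *v y \<omega>) \<le> \<alpha> * l1_norm (F *v y \<omega>)}
         \<ge> 1 - 2 * exp (- \<beta>\<^sup>2 / 2)"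
proof -
  define q where "q = real k * (1 + ln (2 * real CARD('n) / real k))"
  define I where "I = {U :: (2 \<times> 'n) set. card U \<le> k}"
  \<comment> \<open>\<open>A\<close> and \<open>B\<close> are the two failure events: a large
    \<open>k1_norm\<close> and a small \<open>l1_norm\<close>. Outside both, the hypothesis links
    the two bounds.\<close>
  define A where "A = {z. \<exists>U\<in>I. (sqrt (2 * q) + \<beta>) * sigma_const k F < selected_rows F U \<bullet> z}"
  define B where "B = {z. (\<Sum>i\<in>UNIV. \<bar>row i F \<bullet> z\<bar>)
    < sqrt (2 / pi) * (\<Sum>i\<in>UNIV. norm (row i F)) - \<beta> * L_const F}"
  define E where "E = {z. k1_norm k (F *v z) \<le> \<alpha> * l1_norm (F *v z)}"
  have "real k \<le> 2 * real CARD('n)" "0 < real k"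
    using assms(1,2) by simp_all
  then have "0 \<le> ln (2 * real CARD('n) / real k)"
    by (intro ln_ge_zero) (simp add: field_simps)
  then have q: "0 \<le> q" by (simp add: q_def)
  \<comment> \<open>The index type has 2n elements, which is the source of 2n / k in the
    logarithm.\<close>
  have card_I: "real (card I) \<le> exp q"
    using card_subsets_le[of "UNIV :: (2 \<times> 'n) set" k] assms(1,2) by (simp add: I_def q_def)
  have A: "measure gauss A \<le> exp (- \<beta>\<^sup>2 / 2)"
    unfolding A_def
    by (rule gauss_finite_upper_tail[OF _ card_I _ q])
      (use assms(4) in \<open>auto simp: I_def intro: norm_selected_rows_le\<close>)
  have B: "measure gauss B \<le> exp (- \<beta>\<^sup>2 / 2)"
    unfolding B_def
    by (rule gauss_sum_abs_lower_tail) (use assms(4) in \<open>auto intro: norm_weighted_rows_le\<close>)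
  have "z \<in> E" if "z \<notin> A" "z \<notin> B" for z
  proof -
    have "k1_norm k (F *v z) \<le> (sqrt (2 * q) + \<beta>) * sigma_const k F"
      using that(1) by (intro k1_norm_selected_rows[OF assms(2)]) (auto simp: A_def I_def not_less)
    also have "\<dots> \<le> (sqrt (2 / pi) * (\<Sum>i\<in>UNIV. norm (row i F)) - \<beta> * L_const F) * \<alpha>"
      using assms(5) by (simp add: q_def mult.assoc)
    also have "\<dots> \<le> l1_norm (F *v z) * \<alpha>"
      using that(2) assms(3) by (intro mult_right_mono) (auto simp: B_def l1_norm_rows)
    finally show ?thesis by (simp add: E_def mult.commute)
  qed
  then have sub: "UNIV \<subseteq> E \<union> (A \<union> B)" by blast
  \<comment> \<open>Measurability is read off a finite intersection over index sets, avoiding the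
    sorted list; the empty set shows that the family is nonempty.\<close>
  have "E = (\<Inter>S\<in>{S. card S \<le> k}. {z. (\<Sum>i\<in>S. \<bar>row i F \<bullet> z\<bar>) \<le> \<alpha> * (\<Sum>i\<in>UNIV. \<bar>row i F \<bullet> z\<bar>)})"
    unfolding E_def k1_norm_le_iff[OF assms(2)] l1_norm_rows
    by (auto simp: matrix_vector_mult_def row_def inner_vec_def)
  also have "\<dots> \<in> sets borel"
    by (intro sets.finite_INT) (auto intro!: exI[of _ "{}"])
  finally have E_meas [measurable]: "E \<in> sets borel" .
  have [measurable]: "A \<in> sets borel" "B \<in> sets borel"
    unfolding A_def B_def by measurable
  have "1 \<le> measure gauss (E \<union> (A \<union> B))"
    using sub by (simp add: top.extremum_unique)
  also have "\<dots> \<le> measure gauss E + (measure gauss A + measure gauss B)"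
    by (intro order_trans[OF measure_Un_le] add_left_mono measure_Un_le) auto
  finally have "1 - 2 * exp (- \<beta>\<^sup>2 / 2) \<le> measure gauss E"
    using A B by simp
  moreover have "distr M lborel y = gauss"
    using distributed_distr_eq_density[OF assms(7)] by (simp add: gauss_def std_gaussian_density_eq)
  then have "measure gauss E = measure M (y -` E \<inter> space M)"
    using measure_distr[of y M lborel E] distributed_measurable[OF assms(7)] by simp
  moreover have "y -` E \<inter> space M = {\<omega> \<in> space M. k1_norm k (F *v y \<omega>) \<le> \<alpha> * l1_norm (F *v y \<omega>)}"
    by (auto simp: E_def)
  ultimately show ?thesis by simp
qed

end
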